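(* A complex Finsler space $(M,F)$ of complex dimension $2$ is a complex Berwald space if and only if it is weakly Kähler and $\dot\partial_{\bar h}G^i=0$ for all $i,h\in\{1,2\}$.
   Context: $M$ is a complex manifold with $\dim_{\mathbb C}M=2$; $T'M$ is its holomorphic tangent bundle with local coordinates $(z^k,\eta^k)_{k=1,2}$; $\widetilde{T'M}$ is $T'M$ minus the zero section. A complex Finsler space $(M,F)$: $F:T'M\to[0,\infty)$ is continuous, $L:=F^2$ is smooth on $\widetilde{T'M}$, $F(z,\eta)=0$ iff $\eta=0$, $F(z,\lambda\eta)=|\lambda|F(z,\eta)$ for all $\lambda\in\mathbb C$, and the Hermitian matrix $g_{i\bar j}:=\partial^2L/\partial\eta^i\partial\bar\eta^j$ is positive definite on $\widetilde{T'M}$. Repeated indices are summed over $\{1,2\}$; everything lives on $\widetilde{T'M}$. $(g^{\bar m i})$ is the inverse matrix: $g^{\bar m i}g_{j\bar m}=\delta^i_j$. Chern–Finsler connection: $\dot\partial_k:=\partial/\partial\eta^k$, $\dot\partial_{\bar k}:=\partial/\partial\bar\eta^k$, $N^k_j:=g^{\bar mk}\frac{\partial g_{l\bar m}}{\partial z^j}\eta^l$, $\delta_k:=\frac{\partial}{\partial z^k}-N^j_k\dot\partial_j$, $L^i_{jk}:=g^{\bar li}\delta_kg_{j\bar l}$. The spray coefficients are $G^i:=\frac12N^i_j\eta^j$. With $T^i_{jk}:=L^i_{jk}-L^i_{kj}$, the space is Kähler if $T^i_{jk}\eta^j=0$ (known to be equivalent to $T^i_{jk}=0$), and weakly Kähler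 if $g_{i\bar l}T^i_{jk}\eta^j\bar\eta^l=0$. It is a complex Berwald space if it is Kähler and the coefficients $L^i_{jk}=L^i_{jk}(z)$ do not depend on $\eta$. *)

theory Defs
  imports "HOL-Analysis.Analysis"
begin

section \<open>Complex manifolds\<close>

text \<open>For a map on an open set \<open>S\<close>, Frechet differentiability with complex linear
  derivative at every point is holomorphy in several complex variables.\<close>

definition hol_map_on :: "(complex^'n::finite) set \<Rightarrow> (complex^'n \<Rightarrow> complex^'n) \<Rightarrow> bool" where
  "hol_map_on S f \<longleftrightarrow>
     (\<forall>x\<in>S. f differentiable (at x) \<and>
        (\<forall>c v. frechet_derivative f (at x) (c *s v) = c *s frechet_derivative f (at x) v))"

text \<open>A chart is its domain together with its coordinate map; only the values of the
  coordinate map on the domain matter.\<close>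

type_synonym ('m, 'n) chart = "'m set \<times> ('m \<Rightarrow> complex^'n)"

definition chart_image :: "('m, 'n) chart \<Rightarrow> (complex^'n) set" where
  "chart_image c = snd c ` fst c"

definition transition :: "('m, 'n) chart \<Rightarrow> ('m, 'n) chart \<Rightarrow> complex^'n \<Rightarrow> complex^'n" where
  "transition c d = (\<lambda>z. snd d (inv_into (fst c) (snd c) z))"

text \<open>The atlas is any holomorphic atlas, not necessarily a maximal one. The complex dimension
  is the cardinality of \<open>'n\<close>.\<close>

definition complex_manifold :: "'m topology \<Rightarrow> ('m, 'n::finite) chart set \<Rightarrow> bool" where
  "complex_manifold M A \<longleftrightarrow>
     Hausdorff_space M \<and> second_countable M \<and>
     (\<Union>c\<in>A. fst c) = topspace M \<and>
     (\<forall>c\<in>A. openin M (fst c) \<and> open (chart_image c) \<and>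
        homeomorphic_map (subtopology M (fst c)) (top_of_set (chart_image c)) (snd c)) \<and>
     (\<forall>c\<in>A. \<forall>d\<in>A. hol_map_on (snd c ` (fst c \<inter> fst d)) (transition c d))"


section \<open>The holomorphic tangent bundle\<close>

text \<open>A holomorphic tangent vector at \<open>p\<close> is given by its components in all charts around
  \<open>p\<close>, which transform by the Jacobian matrices of the coordinate changes. It is set to \<open>0\<close>
  on all other arguments, so that equality of tangent vectors is equality of functions.\<close>

definition hol_tangent_space ::
    "('m, 'n::finite) chart set \<Rightarrow> 'm \<Rightarrow> (('m, 'n) chart \<Rightarrow> complex^'n) set" where
  "hol_tangent_space A p =
     {v. (\<forall>c. \<not> (c \<in> A \<and> p \<in> fst c) \<longrightarrow> v c = 0) \<and>
         (\<forall>c\<in>A. \<forall>d\<in>A. p \<in> fst c \<and> p \<in> fst d \<longrightarrow>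
            v d = frechet_derivative (transition c d) (at (snd c p)) (v c))}"

definition hol_tangent_bundle ::
    "'m topology \<Rightarrow> ('m, 'n::finite) chart set \<Rightarrow> ('m \<times> (('m, 'n) chart \<Rightarrow> complex^'n)) set" where
  "hol_tangent_bundle M A = (SIGMA p : topspace M. hol_tangent_space A p)"

text \<open>The induced coordinates \<open>(z, \<eta>)\<close> on the part of the tangent bundle over a chart.\<close>

definition bundle_chart ::
    "('m, 'n) chart \<Rightarrow> 'm \<times> (('m, 'n) chart \<Rightarrow> complex^'n) \<Rightarrow> (complex^'n) \<times> (complex^'n)" where
  "bundle_chart c w = (snd c (fst w), snd w c)"

definition local_expr ::
    "'m topology \<Rightarrow> ('m, 'n::finite) chart set \<Rightarrow> ('m \<times> (('m, 'n) chart \<Rightarrow> complex^'n) \<Rightarrow> real)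
      \<Rightarrow> ('m, 'n) chart \<Rightarrow> (complex^'n) \<times> (complex^'n) \<Rightarrow> real" where
  "local_expr M A f c =
     (\<lambda>x. f (inv_into {w \<in> hol_tangent_bundle M A. fst w \<in> fst c} (bundle_chart c) x))"

text \<open>The coordinate domain of the tangent bundle without its zero section.\<close>

definition slit_domain :: "('m, 'n::finite) chart \<Rightarrow> ((complex^'n) \<times> (complex^'n)) set" where
  "slit_domain c = chart_image c \<times> (UNIV - {0})"


section \<open>Local differential calculus\<close>

primrec C_k_on ::
    "nat \<Rightarrow> 'a::real_normed_vector set \<Rightarrow> ('a \<Rightarrow> 'b::real_normed_vector) \<Rightarrow> bool" where
  "C_k_on 0 S f \<longleftrightarrow> continuous_on S f"
| "C_k_on (Suc k) S f \<longleftrightarrow>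
     (\<forall>x\<in>S. f differentiable (at x)) \<and>
     (\<forall>v. C_k_on k S (\<lambda>x. frechet_derivative f (at x) v))"

definition C_infinity_on ::
    "'a::real_normed_vector set \<Rightarrow> ('a \<Rightarrow> 'b::real_normed_vector) \<Rightarrow> bool" where
  "C_infinity_on S f \<longleftrightarrow> (\<forall>k. C_k_on k S f)"

text \<open>The Wirtinger derivatives \<open>\<partial>/\<partial>z\<^sup>k\<close>, \<open>\<partial>/\<partial>\<eta>\<^sup>k\<close> and \<open>\<partial>/\<partial>\<eta>\<^sup>k\<close>-bar: for \<open>\<zeta> = s + \<i> t\<close>,
  \<open>\<partial>/\<partial>\<zeta> = (\<partial>/\<partial>s - \<i> \<partial>/\<partial>t) / 2\<close> and the conjugate operator has the opposite sign.\<close>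

definition d_z :: "'n::finite \<Rightarrow> ((complex^'n) \<times> (complex^'n) \<Rightarrow> complex)
      \<Rightarrow> (complex^'n) \<times> (complex^'n) \<Rightarrow> complex" where
  "d_z k f x = (frechet_derivative f (at x) (axis k 1, 0)
                - \<i> * frechet_derivative f (at x) (axis k \<i>, 0)) / 2"

definition d_eta :: "'n::finite \<Rightarrow> ((complex^'n) \<times> (complex^'n) \<Rightarrow> complex)
      \<Rightarrow> (complex^'n) \<times> (complex^'n) \<Rightarrow> complex" where
  "d_eta k f x = (frechet_derivative f (at x) (0, axis k 1)
                  - \<i> * frechet_derivative f (at x) (0, axis k \<i>)) / 2"

definition d_eta_bar :: "'n::finite \<Rightarrow> ((complex^'n) \<times> (complex^'n) \<Rightarrow> complex)
      \<Rightarrow> (complex^'n) \<times> (complex^'n) \<Rightarrow> complex" where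
  "d_eta_bar k f x = (frechet_derivative f (at x) (0, axis k 1)
                      + \<i> * frechet_derivative f (at x) (0, axis k \<i>)) / 2"


section \<open>The Chern-Finsler connection in local coordinates\<close>

text \<open>Throughout, \<open>L\<close> is the square of the Finsler function in local coordinates and
  \<open>x = (z, \<eta>)\<close>. Upper indices come first: \<open>N_coeff L k j\<close> is \<open>N\<^sup>k\<^sub>j\<close> and
  \<open>L_coeff L i j k\<close> is \<open>L\<^sup>i\<^sub>j\<^sub>k\<close>.\<close>

definition g_mat :: "((complex^'n::finite) \<times> (complex^'n) \<Rightarrow> real)
      \<Rightarrow> (complex^'n) \<times> (complex^'n) \<Rightarrow> complex^'n^'n" where
  "g_mat L x = (\<chi> i j. d_eta i (d_eta_bar j (\<lambda>y. complex_of_real (L y))) x)"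

text \<open>Row index barred, column index unbarred: the sum over \<open>m\<close> of
  \<open>g_mat L x $ j $ m * g_inv L x $ m $ i\<close> is the Kronecker delta.\<close>

definition g_inv :: "((complex^'n::finite) \<times> (complex^'n) \<Rightarrow> real)
      \<Rightarrow> (complex^'n) \<times> (complex^'n) \<Rightarrow> complex^'n^'n" where
  "g_inv L x = matrix_inv (g_mat L x)"

definition N_coeff :: "((complex^'n::finite) \<times> (complex^'n) \<Rightarrow> real) \<Rightarrow> 'n \<Rightarrow> 'n
      \<Rightarrow> (complex^'n) \<times> (complex^'n) \<Rightarrow> complex" where
  "N_coeff L k j x =
     (\<Sum>m\<in>UNIV. \<Sum>l\<in>UNIV. g_inv L x $ m $ k * d_z j (\<lambda>y. g_mat L y $ l $ m) x * snd x $ l)"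

definition delta :: "((complex^'n::finite) \<times> (complex^'n) \<Rightarrow> real) \<Rightarrow> 'n
      \<Rightarrow> ((complex^'n) \<times> (complex^'n) \<Rightarrow> complex) \<Rightarrow> (complex^'n) \<times> (complex^'n) \<Rightarrow> complex" where
  "delta L k f x = d_z k f x - (\<Sum>j\<in>UNIV. N_coeff L j k x * d_eta j f x)"

definition L_coeff :: "((complex^'n::finite) \<times> (complex^'n) \<Rightarrow> real) \<Rightarrow> 'n \<Rightarrow> 'n \<Rightarrow> 'n
      \<Rightarrow> (complex^'n) \<times> (complex^'n) \<Rightarrow> complex" where
  "L_coeff L i j k x = (\<Sum>l\<in>UNIV. g_inv L x $ l $ i * delta L k (\<lambda>y. g_mat L y $ j $ l) x)"

definition G_spray :: "((complex^'n::finite) \<times> (complex^'n) \<Rightarrow> real) \<Rightarrow> 'n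
      \<Rightarrow> (complex^'n) \<times> (complex^'n) \<Rightarrow> complex" where
  "G_spray L i x = 1/2 * (\<Sum>j\<in>UNIV. N_coeff L i j x * snd x $ j)"

definition T_torsion :: "((complex^'n::finite) \<times> (complex^'n) \<Rightarrow> real) \<Rightarrow> 'n \<Rightarrow> 'n \<Rightarrow> 'n
      \<Rightarrow> (complex^'n) \<times> (complex^'n) \<Rightarrow> complex" where
  "T_torsion L i j k x = L_coeff L i j k x - L_coeff L i k j x"


section \<open>Complex Finsler spaces\<close>

definition hermitian_pos_def :: "complex^'n^'n::finite \<Rightarrow> bool" where
  "hermitian_pos_def H \<longleftrightarrow>
     (\<forall>i j. H $ j $ i = cnj (H $ i $ j)) \<and>
     (\<forall>v. v \<noteq> 0 \<longrightarrow> 0 < Re (\<Sum>i\<in>UNIV. \<Sum>j\<in>UNIV. H $ i $ j * v $ i * cnj (v $ j)))"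

text \<open>The function \<open>L = F\<^sup>2\<close> in the coordinates induced by the chart \<open>c\<close>.\<close>

definition L_local ::
    "'m topology \<Rightarrow> ('m, 'n::finite) chart set \<Rightarrow> ('m \<times> (('m, 'n) chart \<Rightarrow> complex^'n) \<Rightarrow> real)
      \<Rightarrow> ('m, 'n) chart \<Rightarrow> (complex^'n) \<times> (complex^'n) \<Rightarrow> real" where
  "L_local M A F c = local_expr M A (\<lambda>w. (F w)\<^sup>2) c"

text \<open>Continuity and smoothness on the tangent bundle are continuity and smoothness in the
  induced coordinates.\<close>

definition complex_finsler_space ::
    "'m topology \<Rightarrow> ('m, 'n::finite) chart set \<Rightarrow> ('m \<times> (('m, 'n) chart \<Rightarrow> complex^'n) \<Rightarrow> real)
      \<Rightarrow> bool" where
  "complex_finsler_space M A F \<longleftrightarrow>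
     complex_manifold M A \<and>
     (\<forall>w\<in>hol_tangent_bundle M A. 0 \<le> F w) \<and>
     (\<forall>c\<in>A. continuous_on (chart_image c \<times> UNIV) (local_expr M A F c)) \<and>
     (\<forall>c\<in>A. C_infinity_on (slit_domain c) (L_local M A F c)) \<and>
     (\<forall>(p, v)\<in>hol_tangent_bundle M A. F (p, v) = 0 \<longleftrightarrow> v = (\<lambda>_. 0)) \<and>
     (\<forall>(p, v)\<in>hol_tangent_bundle M A. \<forall>a::complex. F (p, \<lambda>c. a *s v c) = cmod a * F (p, v)) \<and>
     (\<forall>c\<in>A. \<forall>x\<in>slit_domain c. hermitian_pos_def (g_mat (L_local M A F c) x))"

definition kahler_finsler ::
    "'m topology \<Rightarrow> ('m, 'n::finite) chart set \<Rightarrow> ('m \<times> (('m, 'n) chart \<Rightarrow> complex^'n) \<Rightarrow> real)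
      \<Rightarrow> bool" where
  "kahler_finsler M A F \<longleftrightarrow>
     (\<forall>c\<in>A. \<forall>x\<in>slit_domain c. \<forall>i k.
        (\<Sum>j\<in>UNIV. T_torsion (L_local M A F c) i j k x * snd x $ j) = 0)"

definition weakly_kahler_finsler ::
    "'m topology \<Rightarrow> ('m, 'n::finite) chart set \<Rightarrow> ('m \<times> (('m, 'n) chart \<Rightarrow> complex^'n) \<Rightarrow> real)
      \<Rightarrow> bool" where
  "weakly_kahler_finsler M A F \<longleftrightarrow>
     (\<forall>c\<in>A. \<forall>x\<in>slit_domain c. \<forall>k.
        (\<Sum>i\<in>UNIV. \<Sum>l\<in>UNIV. \<Sum>j\<in>UNIV.
           g_mat (L_local M A F c) x $ i $ l * T_torsion (L_local M A F c) i j k x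
             * snd x $ j * cnj (snd x $ l)) = 0)"

definition complex_berwald ::
    "'m topology \<Rightarrow> ('m, 'n::finite) chart set \<Rightarrow> ('m \<times> (('m, 'n) chart \<Rightarrow> complex^'n) \<Rightarrow> real)
      \<Rightarrow> bool" where
  "complex_berwald M A F \<longleftrightarrow>
     kahler_finsler M A F \<and>
     (\<forall>c\<in>A. \<forall>z\<in>chart_image c. \<forall>\<eta> \<eta>'. \<eta> \<noteq> 0 \<and> \<eta>' \<noteq> 0 \<longrightarrow>
        (\<forall>i j k. L_coeff (L_local M A F c) i j k (z, \<eta>) = L_coeff (L_local M A F c) i j k (z, \<eta>')))"

end

theory Submission
  imports Defs "HOL-Complex_Analysis.Complex_Analysis"
begin

text \<open>Write \<open>L\<^sub>i\<close> for the derivative of \<open>L\<close> along \<open>\<eta>\<^sup>i\<close>. Homogeneity turns the weak Kaehler condition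
  into \<open>\<partial>L/\<partial>z\<^sup>k = \<Sum>\<^sub>i L\<^sub>i \<cdot> \<partial>G\<^sup>i/\<partial>\<eta>\<^sup>k\<close>. If \<open>G\<close> is holomorphic in \<open>\<eta>\<close>, differentiating this in
  \<open>\<eta>\<^sup>m\<close>-bar only hits \<open>L\<^sub>i\<close> and gives \<open>N\<^sup>i\<^sub>k = \<partial>G\<^sup>i/\<partial>\<eta>\<^sup>k\<close>, which is the Kaehler condition. Then
  \<open>L\<^sup>i\<^sub>j\<^sub>k = \<partial>N\<^sup>i\<^sub>k/\<partial>\<eta>\<^sup>j\<close> is holomorphic in \<open>\<eta> \<noteq> 0\<close> and homogeneous of degree \<open>0\<close>; along a complex
  line that misses the origin it is entire with a limit at infinity, hence constant by Liouville.
  Conversely \<open>2 G\<^sup>i = \<Sum>\<^sub>j\<^sub>k L\<^sup>i\<^sub>j\<^sub>k \<eta>\<^sup>j \<eta>\<^sup>k\<close>, so \<open>G\<close> is holomorphic in \<open>\<eta>\<close> if \<open>L\<^sup>i\<^sub>j\<^sub>k\<close> does not depend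
  on \<open>\<eta>\<close>.\<close>

section \<open>Iterated directional derivatives\<close>

abbreviation dirD :: "'a::real_normed_vector \<Rightarrow> ('a \<Rightarrow> 'b::real_normed_vector) \<Rightarrow> 'a \<Rightarrow> 'b" where
  "dirD v f x \<equiv> frechet_derivative f (at x) v"

section \<open>Closure of smooth functions under algebraic operations\<close>

lemma frechet_derivative_eqI: "(f has_derivative f') (at x) \<Longrightarrow> frechet_derivative f (at x) = f'"
  using frechet_derivative_at by blast

lemma differentiable_cong_open:
  assumes "open S" "x \<in> S" "\<And>y. y \<in> S \<Longrightarrow> f y = g y" "f differentiable (at x)"
  shows "g differentiable (at x)"
  using assms has_derivative_transform_within_open unfolding differentiable_def by blast

lemma dirD_cong_open:
  assumes "open S" "x \<in> S" "\<And>y. y \<in> S \<Longrightarrow> f y = g y"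
  shows "dirD v f x = dirD v g x"
proof (cases "f differentiable (at x)")
  case True
  then show ?thesis
    using frechet_derivative_transform_within_open[OF True assms] by simp
next
  case False
  \<comment> \<open>Without a derivative, \<open>frechet_derivative\<close> is still a choice from
    the predicate \<open>has_derivative\<close>. Since f and g satisfy that predicate for the same
    maps, the choice is the same.\<close>
  have "(f has_derivative h) (at x) \<longleftrightarrow> (g has_derivative h) (at x)" for h
    using has_derivative_transform_within_open[of f h x UNIV S g]
      has_derivative_transform_within_open[of g h x UNIV S f] assms by auto
  then show ?thesis by (simp add: frechet_derivative_def)
qed

text \<open>Sum and product rules describe a derivative only at points of S. Since S is open, an
  equation valid on S passes to derivatives of every order, which lets such formulas be used in
  inductions on k.\<close>

lemma C_k_on_cong:
  assumes "open S" "\<And>x. x \<in> S \<Longrightarrow> f x = g x" "C_k_on k S f"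
  shows "C_k_on k S g"
  using assms(2,3)
proof (induction k arbitrary: f g)
  case 0
  then show ?case by (simp cong: continuous_on_cong)
next
  case (Suc k)
  have "C_k_on k S (\<lambda>x. dirD v g x)" for v
  proof (rule Suc.IH[of "\<lambda>x. dirD v f x"])
    show "dirD v f x = dirD v g x" if "x \<in> S" for x
      by (rule dirD_cong_open[OF assms(1) that Suc.prems(1)])
  qed (use Suc.prems in auto)
  moreover have "g differentiable (at x)" if "x \<in> S" for x
    by (rule differentiable_cong_open[OF assms(1) that Suc.prems(1)]) (use Suc.prems(2) that in auto)
  ultimately show ?case by auto
qed

lemma C_k_on_Suc_D: "C_k_on (Suc k) S f \<Longrightarrow> C_k_on k S f"
proof (induction k arbitrary: f)
  case 0
  then show ?case
    by (auto intro!: continuous_at_imp_continuous_on differentiable_imp_continuous_within)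
next
  case (Suc k)
  then show ?case by (metis C_k_on.simps(2))
qed

lemma C_k_on_const: "C_k_on k S (\<lambda>x. c)"
  by (induction k arbitrary: c) auto

lemma C_k_on_bounded_linear:
  assumes "bounded_linear h"
  shows "C_k_on k S h"
proof (cases k)
  case 0
  then show ?thesis
    using assms linear_continuous_on by auto
next
  case (Suc m)
  have "frechet_derivative h (at x) = h" for x
    using bounded_linear_imp_has_derivative[OF assms] by (rule frechet_derivative_eqI)
  then show ?thesis
    using assms bounded_linear_imp_differentiable by (auto simp: Suc C_k_on_const)
qed

lemma dirD_bounded_linear:
  assumes "bounded_linear h" "f differentiable (at x)"
  shows "dirD v (\<lambda>y. h (f y)) x = h (dirD v f x)"
  using bounded_linear.has_derivative[OF assms(1) frechet_derivative_works[THEN iffD1, OF assms(2)]]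
  by (simp add: frechet_derivative_eqI)

lemma differentiable_bounded_linear:
  assumes "bounded_linear h" "f differentiable (at x)"
  shows "(\<lambda>y. h (f y)) differentiable (at x)"
  using bounded_linear.has_derivative[OF assms(1)] assms(2) unfolding differentiable_def by blast

lemma C_k_on_compose_bounded_linear:
  assumes "open S" "bounded_linear h" "C_k_on k S f"
  shows "C_k_on k S (\<lambda>x. h (f x))"
  using assms(3)
proof (induction k arbitrary: f)
  case 0
  then show ?case
    using assms(2) by (simp add: bounded_linear.continuous_on)
next
  case (Suc k)
  have "C_k_on k S (\<lambda>x. dirD v (\<lambda>y. h (f y)) x)" for v
  proof (rule C_k_on_cong[OF assms(1)])
    show "C_k_on k S (\<lambda>x. h (dirD v f x))"
      using Suc by auto
    show "h (dirD v f x) = dirD v (\<lambda>y. h (f y)) x" if "x \<in> S" for x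
      using Suc.prems that by (intro dirD_bounded_linear[OF assms(2), symmetric]) auto
  qed
  then show ?case
    using Suc.prems differentiable_bounded_linear[OF assms(2)] by auto
qed

lemma dirD_add:
  assumes "f differentiable (at x)" "g differentiable (at x)"
  shows "dirD v (\<lambda>y. f y + g y) x = dirD v f x + dirD v g x"
  using has_derivative_add[OF assms[THEN frechet_derivative_works[THEN iffD1]]]
  by (simp add: frechet_derivative_eqI)

lemma C_k_on_add:
  assumes "open S" "C_k_on k S f" "C_k_on k S g"
  shows "C_k_on k S (\<lambda>x. f x + g x)"
  using assms(2,3)
proof (induction k arbitrary: f g)
  case 0
  then show ?case by (auto intro: continuous_intros)
next
  case (Suc k)
  have "C_k_on k S (\<lambda>x. dirD v (\<lambda>y. f y + g y) x)" for v
  proof (rule C_k_on_cong[OF assms(1)])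
    show "C_k_on k S (\<lambda>x. dirD v f x + dirD v g x)"
      using Suc by auto
    show "dirD v f x + dirD v g x = dirD v (\<lambda>y. f y + g y) x" if "x \<in> S" for x
      using Suc.prems that by (intro dirD_add[symmetric]) auto
  qed
  then show ?case
    using Suc.prems by auto
qed

lemma dirD_mult:
  fixes f g :: "'a::real_normed_vector \<Rightarrow> 'b::real_normed_algebra"
  assumes "f differentiable (at x)" "g differentiable (at x)"
  shows "dirD v (\<lambda>y. f y * g y) x = f x * dirD v g x + dirD v f x * g x"
  using has_derivative_mult[OF assms[THEN frechet_derivative_works[THEN iffD1]]]
  by (simp add: frechet_derivative_eqI)

lemma C_k_on_mult:
  fixes f g :: "'a::real_normed_vector \<Rightarrow> 'b::real_normed_algebra"
  assumes "open S" "C_k_on k S f" "C_k_on k S g"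
  shows "C_k_on k S (\<lambda>x. f x * g x)"
  using assms(2,3)
proof (induction k arbitrary: f g)
  case 0
  then show ?case by (auto intro: continuous_intros)
next
  case (Suc k)
  have "C_k_on k S (\<lambda>x. dirD v (\<lambda>y. f y * g y) x)" for v
  proof (rule C_k_on_cong[OF assms(1)])
    have "C_k_on k S f" "C_k_on k S g"
      using Suc.prems by (blast dest: C_k_on_Suc_D)+
    then show "C_k_on k S (\<lambda>x. f x * dirD v g x + dirD v f x * g x)"
      using Suc by (intro C_k_on_add[OF assms(1)]) auto
    show "f x * dirD v g x + dirD v f x * g x = dirD v (\<lambda>y. f y * g y) x" if "x \<in> S" for x
      using Suc.prems that by (intro dirD_mult[symmetric]) auto
  qed
  then show ?case
    using Suc.prems by (auto intro: derivative_intros)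
qed

text \<open>The derivative of 1/f is minus f' times the square of 1/f. The induction closes because
  1/f enters that formula with smoothness k only, which the induction hypothesis supplies.\<close>

lemma C_k_on_inverse:
  fixes f :: "'a::real_normed_vector \<Rightarrow> 'b::real_normed_field"
  assumes "open S" "\<And>x. x \<in> S \<Longrightarrow> f x \<noteq> 0" "C_k_on k S f"
  shows "C_k_on k S (\<lambda>x. inverse (f x))"
  using assms(3)
proof (induction k)
  case 0
  then show ?case using assms(2) by (auto intro: continuous_intros)
next
  case (Suc k)
  have d: "((\<lambda>y. inverse (f y)) has_derivative (\<lambda>v. - (inverse (f x) * dirD v f x * inverse (f x)))) (at x)"
    if "x \<in> S" for x
    using assms(2)[OF that] Suc.prems that frechet_derivative_works
    by (intro Deriv.has_derivative_inverse) auto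
  have k: "C_k_on k S (\<lambda>x. inverse (f x))"
    using Suc C_k_on_Suc_D by blast
  have "C_k_on k S (\<lambda>x. dirD v (\<lambda>y. inverse (f y)) x)" for v
  proof (rule C_k_on_cong[OF assms(1)])
    show "C_k_on k S (\<lambda>x. - (inverse (f x) * dirD v f x * inverse (f x)))"
      using Suc.prems k
      by (intro C_k_on_compose_bounded_linear[OF assms(1), of uminus] C_k_on_mult assms(1))
        (auto intro: bounded_linear_minus bounded_linear_ident)
  qed (use frechet_derivative_eqI[OF d] in simp)
  then show ?case
    using d unfolding differentiable_def C_k_on.simps by blast
qed

lemma C_infinity_on_differentiable:
  "C_infinity_on S f \<Longrightarrow> x \<in> S \<Longrightarrow> f differentiable (at x)"
  unfolding C_infinity_on_def by (metis C_k_on.simps(2))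

lemma C_infinity_on_dirD: "C_infinity_on S f \<Longrightarrow> C_infinity_on S (\<lambda>x. dirD v f x)"
  unfolding C_infinity_on_def by (metis C_k_on.simps(2))

lemma C_infinity_on_const: "C_infinity_on S (\<lambda>x. c)"
  by (simp add: C_infinity_on_def C_k_on_const)

lemma C_infinity_on_bounded_linear: "bounded_linear h \<Longrightarrow> C_infinity_on S h"
  by (simp add: C_infinity_on_def C_k_on_bounded_linear)

lemma C_infinity_on_compose_bounded_linear:
  "open S \<Longrightarrow> bounded_linear h \<Longrightarrow> C_infinity_on S f \<Longrightarrow> C_infinity_on S (\<lambda>x. h (f x))"
  by (simp add: C_infinity_on_def C_k_on_compose_bounded_linear)

lemma C_infinity_on_cong:
  "open S \<Longrightarrow> (\<And>x. x \<in> S \<Longrightarrow> f x = g x) \<Longrightarrow> C_infinity_on S f \<Longrightarrow> C_infinity_on S g"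
  unfolding C_infinity_on_def using C_k_on_cong by blast

lemma C_infinity_on_add:
  "open S \<Longrightarrow> C_infinity_on S f \<Longrightarrow> C_infinity_on S g \<Longrightarrow> C_infinity_on S (\<lambda>x. f x + g x)"
  by (simp add: C_infinity_on_def C_k_on_add)

lemma C_infinity_on_mult:
  fixes f g :: "'a::real_normed_vector \<Rightarrow> 'b::real_normed_algebra"
  shows "open S \<Longrightarrow> C_infinity_on S f \<Longrightarrow> C_infinity_on S g \<Longrightarrow> C_infinity_on S (\<lambda>x. f x * g x)"
  by (simp add: C_infinity_on_def C_k_on_mult)

lemma C_infinity_on_diff:
  assumes "open S" "C_infinity_on S f" "C_infinity_on S g"
  shows "C_infinity_on S (\<lambda>x. f x - g x)"
  using C_infinity_on_add[OF assms(1,2) C_infinity_on_compose_bounded_linear[OF assms(1) _ assms(3), of uminus]]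
  by (simp add: bounded_linear_minus bounded_linear_ident)

lemma C_infinity_on_inverse:
  fixes f :: "'a::real_normed_vector \<Rightarrow> 'b::real_normed_field"
  shows "open S \<Longrightarrow> (\<And>x. x \<in> S \<Longrightarrow> f x \<noteq> 0) \<Longrightarrow> C_infinity_on S f \<Longrightarrow> C_infinity_on S (\<lambda>x. inverse (f x))"
  by (simp add: C_infinity_on_def C_k_on_inverse)

lemma C_infinity_on_sum:
  assumes "open S" "\<And>i. i \<in> I \<Longrightarrow> C_infinity_on S (f i)"
  shows "C_infinity_on S (\<lambda>x. \<Sum>i\<in>I. f i x)"
  using assms(2)
  by (induction I rule: infinite_finite_induct)
    (auto intro: C_infinity_on_const C_infinity_on_add[OF assms(1)])

lemma C_infinity_on_prod:
  fixes f :: "'i \<Rightarrow> 'a::real_normed_vector \<Rightarrow> 'b::{real_normed_algebra_1,comm_monoid_mult}"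
  assumes "open S" "\<And>i. i \<in> I \<Longrightarrow> C_infinity_on S (f i)"
  shows "C_infinity_on S (\<lambda>x. \<Prod>i\<in>I. f i x)"
  using assms(2)
  by (induction I rule: infinite_finite_induct)
    (auto intro: C_infinity_on_const C_infinity_on_mult[OF assms(1)])

lemma C_infinity_on_det:
  fixes a :: "'a::real_normed_vector \<Rightarrow> complex^'n::finite^'n"
  assumes "open S" "\<And>i j. C_infinity_on S (\<lambda>x. a x $ i $ j)"
  shows "C_infinity_on S (\<lambda>x. det (a x))"
  unfolding det_def
  by (intro C_infinity_on_sum C_infinity_on_mult C_infinity_on_const C_infinity_on_prod assms)

section \<open>Symmetry of second derivatives\<close>

lemma has_vector_derivative_along_line:
  assumes "f differentiable (at (x + s *\<^sub>R u))"
  shows "((\<lambda>s. f (x + s *\<^sub>R u)) has_vector_derivative dirD u f (x + s *\<^sub>R u)) (at s)"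
proof -
  have "((\<lambda>s. x + s *\<^sub>R u) has_derivative (\<lambda>t. t *\<^sub>R u)) (at s)"
    by (auto intro!: derivative_eq_intros)
  from has_derivative_compose[OF this frechet_derivative_works[THEN iffD1, OF assms]]
  show ?thesis
    unfolding has_vector_derivative_def
    using linear_cmul[OF linear_frechet_derivative[OF assms], of _ u] by simp
qed

text \<open>The mean value theorem is used twice: along u for the increment of f in direction v,
  then along v for \<open>dirD u f\<close>. The second difference is symmetric in u and v, and this
  symmetry is what gets transferred to the mixed derivatives.\<close>

lemma second_difference_mean_value:
  fixes f :: "'a::real_normed_vector \<Rightarrow> real"
  assumes "ball x r \<subseteq> S" "\<And>y. y \<in> S \<Longrightarrow> f differentiable (at y)"
    "\<And>y. y \<in> S \<Longrightarrow> (\<lambda>y. dirD u f y) differentiable (at y)"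
    "0 < t" "t * (norm u + norm v) < r"
  shows "\<exists>p. dist x p \<le> t * (norm u + norm v) \<and>
    f (x + t *\<^sub>R u + t *\<^sub>R v) - f (x + t *\<^sub>R u) - f (x + t *\<^sub>R v) + f x = t * t * dirD v (dirD u f) p"
proof -
  have dist: "dist x (x + a *\<^sub>R u + b *\<^sub>R v) \<le> t * (norm u + norm v)"
    if "0 \<le> a" "a \<le> t" "0 \<le> b" "b \<le> t" for a b
  proof -
    have "dist x (x + a *\<^sub>R u + b *\<^sub>R v) = norm (a *\<^sub>R u + b *\<^sub>R v)"
      by (metis add.assoc add_diff_cancel_left' dist_commute dist_norm)
    also have "\<dots> \<le> a * norm u + b * norm v"
      by (metis norm_triangle_ineq norm_scaleR abs_of_nonneg that(1,3))
    also have "\<dots> \<le> t * norm u + t * norm v"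
      using that by (intro add_mono mult_right_mono) auto
    finally show ?thesis by (simp add: algebra_simps)
  qed
  then have S: "x + a *\<^sub>R u + b *\<^sub>R v \<in> S" if "0 \<le> a" "a \<le> t" "0 \<le> b" "b \<le> t" for a b
    using that assms(1,5) by (meson le_less_trans mem_ball subsetD)
  have "\<exists>a>0. a < t \<and> (f (x + t *\<^sub>R u + t *\<^sub>R v) - f (x + t *\<^sub>R u)) - (f (x + 0 *\<^sub>R u + t *\<^sub>R v) - f (x + 0 *\<^sub>R u))
     = (t - 0) * (dirD u f (x + a *\<^sub>R u + t *\<^sub>R v) - dirD u f (x + a *\<^sub>R u))"
  proof (rule MVT2[OF assms(4)])
    fix a assume a: "0 \<le> a" "a \<le> t"
    have "f differentiable (at (x + t *\<^sub>R v + a *\<^sub>R u))" "f differentiable (at (x + a *\<^sub>R u))"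
      using assms(2) S[of a t] S[of a 0] a by (auto simp: algebra_simps)
    then show "DERIV (\<lambda>s. f (x + s *\<^sub>R u + t *\<^sub>R v) - f (x + s *\<^sub>R u)) a :>
        dirD u f (x + a *\<^sub>R u + t *\<^sub>R v) - dirD u f (x + a *\<^sub>R u)"
      using has_vector_derivative_diff[OF
          has_vector_derivative_along_line[of f "x + t *\<^sub>R v" a u] has_vector_derivative_along_line[of f x a u]]
      by (simp add: has_real_derivative_iff_has_vector_derivative ac_simps)
  qed
  then obtain a where a: "0 < a" "a < t"
    and fa: "f (x + t *\<^sub>R u + t *\<^sub>R v) - f (x + t *\<^sub>R u) - f (x + t *\<^sub>R v) + f x
     = t * (dirD u f (x + a *\<^sub>R u + t *\<^sub>R v) - dirD u f (x + a *\<^sub>R u))"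
    by auto
  have "\<exists>b>0. b < t \<and> dirD u f (x + a *\<^sub>R u + t *\<^sub>R v) - dirD u f (x + a *\<^sub>R u + 0 *\<^sub>R v)
     = (t - 0) * dirD v (dirD u f) (x + a *\<^sub>R u + b *\<^sub>R v)"
  proof (rule MVT2[OF assms(4)])
    fix b assume b: "0 \<le> b" "b \<le> t"
    have "(dirD u f) differentiable (at (x + a *\<^sub>R u + b *\<^sub>R v))"
      using assms(3) S[of a b] a b by auto
    then show "DERIV (\<lambda>b. dirD u f (x + a *\<^sub>R u + b *\<^sub>R v)) b :> dirD v (dirD u f) (x + a *\<^sub>R u + b *\<^sub>R v)"
      using has_vector_derivative_along_line
      by (simp add: has_real_derivative_iff_has_vector_derivative)
  qed
  then obtain b where b: "0 < b" "b < t"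
    and "dirD u f (x + a *\<^sub>R u + t *\<^sub>R v) - dirD u f (x + a *\<^sub>R u) = t * dirD v (dirD u f) (x + a *\<^sub>R u + b *\<^sub>R v)"
    by auto
  with fa dist[of a b] a show ?thesis
    by (intro exI[of _ "x + a *\<^sub>R u + b *\<^sub>R v"]) auto
qed

text \<open>For small t the second difference equals both t^2 P(p) and t^2 Q(q), with p and q near
  x. Continuity of P and Q at x then excludes different values there.\<close>

lemma dirD_commute_real:
  fixes f :: "'a::real_normed_vector \<Rightarrow> real"
  assumes "open S" "x \<in> S" "C_infinity_on S f"
  shows "dirD u (dirD v f) x = dirD v (dirD u f) x"
proof (rule ccontr)
  define P where "P = dirD v (dirD u f)"
  define Q where "Q = dirD u (dirD v f)"
  define e where "e = \<bar>P x - Q x\<bar> / 2"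
  assume "dirD u (dirD v f) x \<noteq> dirD v (dirD u f) x"
  then have e: "e > 0" by (auto simp: e_def P_def Q_def)
  obtain r where r: "r > 0" "ball x r \<subseteq> S"
    using assms by (meson openE)
  have sm: "C_infinity_on S (dirD w f)" for w
    using assms(3) by (rule C_infinity_on_dirD)
  have "isCont P x" "isCont Q x"
    unfolding P_def Q_def
    by (intro differentiable_imp_continuous_within C_infinity_on_differentiable[OF C_infinity_on_dirD[OF sm]] assms(2))+
  then obtain d1 d2 where d: "d1 > 0" "d2 > 0"
    "\<And>y. dist x y < d1 \<Longrightarrow> \<bar>P y - P x\<bar> < e" "\<And>y. dist x y < d2 \<Longrightarrow> \<bar>Q y - Q x\<bar> < e"
    using e unfolding continuous_at_eps_delta by (metis dist_commute dist_real_def)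
  define m where "m = min r (min d1 d2)"
  have m: "m > 0" using d r by (simp add: m_def)
  \<comment> \<open>Adding 1 keeps the denominator positive even if u and v are both 0, and t (|u| +
    |v|) stays below m.\<close>
  define t where "t = m / (norm u + norm v + 1)"
  have c: "norm u + norm v + 1 > 0"
    by (simp add: add_nonneg_pos)
  have t: "t > 0" using m c by (simp add: t_def)
  have tm: "t * (norm u + norm v) < m"
    using m c by (simp add: t_def field_simps)
  then have tr: "t * (norm u + norm v) < r" "t * (norm v + norm u) < r"
    by (simp_all add: m_def add.commute)
  note diff = C_infinity_on_differentiable[OF assms(3)] C_infinity_on_differentiable[OF sm]
  obtain p where p: "dist x p \<le> t * (norm u + norm v)"
    "f (x + t *\<^sub>R u + t *\<^sub>R v) - f (x + t *\<^sub>R u) - f (x + t *\<^sub>R v) + f x = t * t * P p"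
    using second_difference_mean_value[OF r(2) diff t tr(1)] unfolding P_def by auto
  obtain q where q: "dist x q \<le> t * (norm v + norm u)"
    "f (x + t *\<^sub>R v + t *\<^sub>R u) - f (x + t *\<^sub>R v) - f (x + t *\<^sub>R u) + f x = t * t * Q q"
    using second_difference_mean_value[OF r(2) diff t tr(2)] unfolding Q_def by auto
  have "f (x + t *\<^sub>R v + t *\<^sub>R u) = f (x + t *\<^sub>R u + t *\<^sub>R v)"
    by (simp add: algebra_simps)
  with p(2) q(2) have "t * t * P p = t * t * Q q" by linarith
  then have "P p = Q q" using t by simp
  moreover have "\<bar>P p - P x\<bar> < e" "\<bar>Q q - Q x\<bar> < e"
    using d(3)[of p] d(4)[of q] p(1) q(1) tm by (auto simp: m_def add.commute)
  ultimately show False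
    using abs_triangle_ineq4[of "P p - P x" "Q q - Q x"] by (simp add: e_def abs_minus_commute)
qed

text \<open>The mean value argument concerns real values, so real and imaginary parts are treated
  separately; both are bounded linear and commute with \<open>dirD\<close>.\<close>

lemma dirD_commute:
  fixes f :: "'a::real_normed_vector \<Rightarrow> complex"
  assumes "open S" "x \<in> S" "C_infinity_on S f"
  shows "dirD u (dirD v f) x = dirD v (dirD u f) x"
proof -
  have *: "dirD u (dirD v (\<lambda>y. h (f y))) x = h (dirD u (dirD v f) x)"
    if h: "bounded_linear h" for h :: "complex \<Rightarrow> real" and u v
  proof -
    have "dirD u (dirD v (\<lambda>y. h (f y))) x = dirD u (\<lambda>y. h (dirD v f y)) x"
      using assms h
      by (intro dirD_cong_open[OF assms(1,2)] dirD_bounded_linear C_infinity_on_differentiable)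
    also have "\<dots> = h (dirD u (dirD v f) x)"
      by (rule dirD_bounded_linear[OF h C_infinity_on_differentiable[OF C_infinity_on_dirD[OF assms(3)] assms(2)]])
    finally show ?thesis .
  qed
  have "h (dirD u (dirD v f) x) = h (dirD v (dirD u f) x)"
    if h: "bounded_linear h" for h :: "complex \<Rightarrow> real"
    using dirD_commute_real[OF assms(1,2) C_infinity_on_compose_bounded_linear[OF assms(1) h assms(3)]]
    by (simp add: *[OF h])
  then show ?thesis
    by (intro complex_eqI) (auto intro: bounded_linear_Re bounded_linear_Im)
qed


section \<open>Wirtinger operators\<close>

text \<open>A common shape for the three operators: c is -i for \<open>d_z\<close> and
  \<open>d_eta\<close>, and i for \<open>d_eta_bar\<close>. Each rule of calculus is then proved
  once for all of them.\<close>

definition wirtinger :: "complex \<Rightarrow> 'a \<Rightarrow> 'a \<Rightarrow> ('a::real_normed_vector \<Rightarrow> complex) \<Rightarrow> 'a \<Rightarrow> complex" where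
  "wirtinger c u v f x = (dirD u f x + c * dirD v f x) / 2"

definition is_wirtinger :: "(('a::real_normed_vector \<Rightarrow> complex) \<Rightarrow> 'a \<Rightarrow> complex) \<Rightarrow> bool" where
  "is_wirtinger D \<longleftrightarrow> (\<exists>c u v. D = wirtinger c u v)"

lemma is_wirtinger_d [simp]: "is_wirtinger (d_z k)" "is_wirtinger (d_eta k)" "is_wirtinger (d_eta_bar k)"
proof -
  have "d_z k = wirtinger (- \<i>) (axis k 1, 0) (axis k \<i>, 0)"
    "d_eta k = wirtinger (- \<i>) (0, axis k 1) (0, axis k \<i>)"
    "d_eta_bar k = wirtinger \<i> (0, axis k 1) (0, axis k \<i>)"
    by (auto simp: fun_eq_iff wirtinger_def d_z_def d_eta_def d_eta_bar_def)
  then show "is_wirtinger (d_z k)" "is_wirtinger (d_eta k)" "is_wirtinger (d_eta_bar k)"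
    unfolding is_wirtinger_def by blast+
qed

lemma is_wirtinger_cong:
  assumes "is_wirtinger D" "open S" "x \<in> S" "\<And>y. y \<in> S \<Longrightarrow> f y = g y"
  shows "D f x = D g x"
proof -
  have "dirD v f x = dirD v g x" for v
    by (rule dirD_cong_open[OF assms(2-4)])
  then show ?thesis
    using assms(1) by (auto simp: is_wirtinger_def wirtinger_def)
qed

lemma is_wirtinger_C_infinity:
  assumes "is_wirtinger D" "open S" "C_infinity_on S f"
  shows "C_infinity_on S (D f)"
proof -
  obtain c u v where D: "D = wirtinger c u v"
    using assms(1) by (auto simp: is_wirtinger_def)
  have "C_infinity_on S (\<lambda>x. (dirD u f x + c * dirD v f x) * (1/2))"
    by (intro C_infinity_on_mult C_infinity_on_add C_infinity_on_const C_infinity_on_dirD assms)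
  then show ?thesis
    by (simp add: D wirtinger_def[abs_def])
qed

lemma is_wirtinger_const:
  assumes "is_wirtinger D"
  shows "D (\<lambda>y. c) x = 0"
  using assms by (auto simp: is_wirtinger_def wirtinger_def)

lemma is_wirtinger_mult:
  assumes "is_wirtinger D" "f differentiable (at x)" "g differentiable (at x)"
  shows "D (\<lambda>y. f y * g y) x = f x * D g x + D f x * g x"
  using assms by (auto simp: is_wirtinger_def wirtinger_def dirD_mult field_simps)

lemma is_wirtinger_add:
  assumes "is_wirtinger D" "f differentiable (at x)" "g differentiable (at x)"
  shows "D (\<lambda>y. f y + g y) x = D f x + D g x"
  using assms by (auto simp: is_wirtinger_def wirtinger_def dirD_add field_simps)

lemma is_wirtinger_sum:
  assumes "is_wirtinger D" "finite I" "\<And>i. i \<in> I \<Longrightarrow> f i differentiable (at x)"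
  shows "D (\<lambda>y. \<Sum>i\<in>I. f i y) x = (\<Sum>i\<in>I. D (f i) x)"
  using assms(2,3)
proof (induction I)
  case empty
  then show ?case by (simp add: is_wirtinger_const[OF assms(1)])
next
  case (insert i I)
  have "(\<lambda>y. \<Sum>i\<in>I. f i y) differentiable (at x)"
    using insert by (intro differentiable_sum) auto
  with insert show ?case
    by (simp add: is_wirtinger_add[OF assms(1)])
qed

lemma is_wirtinger_sum_mult:
  assumes "is_wirtinger D" "finite I"
    "\<And>i. i \<in> I \<Longrightarrow> f i differentiable (at x)" "\<And>i. i \<in> I \<Longrightarrow> g i differentiable (at x)"
  shows "D (\<lambda>y. \<Sum>i\<in>I. f i y * g i y) x = (\<Sum>i\<in>I. f i x * D (g i) x + D (f i) x * g i x)"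
proof -
  have "D (\<lambda>y. \<Sum>i\<in>I. f i y * g i y) x = (\<Sum>i\<in>I. D (\<lambda>y. f i y * g i y) x)"
    using assms by (intro is_wirtinger_sum differentiable_mult)
  also have "\<dots> = (\<Sum>i\<in>I. f i x * D (g i) x + D (f i) x * g i x)"
    using assms by (intro sum.cong refl is_wirtinger_mult)
  finally show ?thesis .
qed

lemma is_wirtinger_commute:
  assumes "is_wirtinger D" "is_wirtinger E" "open S" "x \<in> S" "C_infinity_on S f"
  shows "D (E f) x = E (D f) x"
proof -
  obtain c u v c' u' v' where D: "D = wirtinger c u v" and E: "E = wirtinger c' u' v'"
    using assms(1,2) by (auto simp: is_wirtinger_def)
  have diff: "dirD w f differentiable (at x)" for w
    by (rule C_infinity_on_differentiable[OF C_infinity_on_dirD[OF assms(5)] assms(4)])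
  \<comment> \<open>The coefficients are constant, so composing two Wirtinger operators yields a
    combination of iterated directional derivatives, to which \<open>dirD_commute\<close>
    applies.\<close>
  have *: "dirD w (wirtinger a p q f) x = (dirD w (dirD p f) x + a * dirD w (dirD q f) x) / 2" for w a p q
  proof -
    have h: "bounded_linear (\<lambda>y::complex. y / 2)" "bounded_linear (\<lambda>y::complex. a * y)"
      by (auto intro: bounded_linear_divide bounded_linear_mult_right)
    note aq = differentiable_bounded_linear[OF h(2) diff[of q]]
    have "dirD w (\<lambda>y. (dirD p f y + a * dirD q f y) / 2) x = dirD w (\<lambda>y. dirD p f y + a * dirD q f y) x / 2"
      by (rule dirD_bounded_linear[OF h(1) differentiable_add[OF diff aq]])
    also have "\<dots> = (dirD w (dirD p f) x + a * dirD w (dirD q f) x) / 2"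
      by (simp only: dirD_add[OF diff aq] dirD_bounded_linear[OF h(2) diff[of q]])
    finally show ?thesis
      unfolding wirtinger_def[abs_def] .
  qed
  note comm = dirD_commute[OF assms(3-5)]
  show ?thesis
    unfolding D E wirtinger_def[of c u v "wirtinger c' u' v' f"]
      wirtinger_def[of c' u' v' "wirtinger c u v f"] *
    by (simp add: comm[of u'] comm[of v'] field_simps)
qed

lemma bounded_linear_eta: "bounded_linear (\<lambda>x. snd x $ l :: complex)"
  using bounded_linear_compose[OF bounded_linear_vec_nth bounded_linear_snd] .

lemma bounded_linear_eta_bar: "bounded_linear (\<lambda>x. cnj (snd x $ l))"
  using bounded_linear_compose[OF bounded_linear_cnj bounded_linear_eta] .

lemma d_eta_coordinate:
  "d_eta k (\<lambda>x. snd x $ l) x = (if k = l then 1 else 0)"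
  "d_eta_bar k (\<lambda>x. snd x $ l) x = 0"
  "d_z k (\<lambda>x. snd x $ l) x = 0"
  "d_eta k (\<lambda>x. cnj (snd x $ l)) x = 0"
  "d_eta_bar k (\<lambda>x. cnj (snd x $ l)) x = (if k = l then 1 else 0)"
  "d_z k (\<lambda>x. cnj (snd x $ l)) x = 0"
  by (simp_all add: d_eta_def d_eta_bar_def d_z_def axis_def
      frechet_derivative_eqI[OF bounded_linear_imp_has_derivative[OF bounded_linear_eta]]
      frechet_derivative_eqI[OF bounded_linear_imp_has_derivative[OF bounded_linear_eta_bar]])

text \<open>Along the fibre the real differential splits into its complex linear and antilinear
  parts. The splitting comes from expanding v in the real basis formed by \<open>axis k 1\<close>
  and \<open>axis k \<i>\<close>.\<close>

lemma dirD_eta_decomposition: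
  assumes "f differentiable (at x)"
  shows "dirD (0, v) f x = (\<Sum>k\<in>UNIV. v $ k * d_eta k f x + cnj (v $ k) * d_eta_bar k f x)"
proof -
  interpret linear "frechet_derivative f (at x)"
    using assms by (rule linear_frechet_derivative)
  have "(0, v) = (\<Sum>k\<in>UNIV. Re (v $ k) *\<^sub>R (0, axis k 1) + Im (v $ k) *\<^sub>R (0, axis k \<i>) :: (complex^'a) \<times> (complex^'a))"
    by (auto simp: prod_eq_iff vec_eq_iff fst_sum snd_sum axis_def complex_eq_iff if_distrib sum.If_cases
        cong: if_cong)
  then have "dirD (0, v) f x = (\<Sum>k\<in>UNIV. Re (v $ k) * dirD (0, axis k 1) f x + Im (v $ k) * dirD (0, axis k \<i>) f x)"
    by (simp only: sum add scale scaleR_conv_of_real)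
  also have "\<dots> = (\<Sum>k\<in>UNIV. v $ k * d_eta k f x + cnj (v $ k) * d_eta_bar k f x)"
    by (intro sum.cong refl)
      (simp add: d_eta_def d_eta_bar_def complex_eq_iff field_simps)
  finally show ?thesis .
qed

section \<open>Inverses of positive definite matrices\<close>

lemma matrix_inv_works:
  fixes H :: "complex^'n::finite^'n"
  assumes "hermitian_pos_def H"
  shows "H ** matrix_inv H = mat 1" "matrix_inv H ** H = mat 1" "invertible H"
proof -
  have "x = 0" if "H *v x = 0" for x
  proof (rule ccontr)
    assume "x \<noteq> 0"
    \<comment> \<open>The form in \<open>hermitian_pos_def\<close> has the conjugated factor in the
      column index, so a kernel vector x must enter as the conjugate of v. The form then vanishes at
      v.\<close>
    define v where "v = (\<chi> i. cnj (x $ i))"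
    have "v \<noteq> 0" using \<open>x \<noteq> 0\<close> by (auto simp: v_def vec_eq_iff)
    then have "0 < Re (\<Sum>i\<in>UNIV. \<Sum>j\<in>UNIV. H $ i $ j * v $ i * cnj (v $ j))"
      using assms unfolding hermitian_pos_def_def by blast
    moreover have "(\<Sum>j\<in>UNIV. H $ i $ j * v $ i * cnj (v $ j)) = v $ i * (H *v x) $ i" for i
      by (simp add: matrix_vector_mult_def v_def sum_distrib_left ac_simps)
    ultimately show False
      by (simp add: that)
  qed
  then have "\<exists>B. B ** H = mat 1"
    using matrix_left_invertible_ker by blast
  then show inv: "invertible H"
    by (simp add: invertible_left_inverse)
  then show "H ** matrix_inv H = mat 1" "matrix_inv H ** H = mat 1"
    unfolding invertible_def matrix_inv_def by (metis (mono_tags, lifting) someI_ex)+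
qed

text \<open>Cramer's rule gives the entries of the inverse as quotients of polynomials in the
  entries of H; this is how smoothness passes from g to its inverse.\<close>

lemma matrix_inv_cramer:
  fixes H :: "complex^'n::finite^'n"
  assumes "invertible H" "H ** matrix_inv H = mat 1"
  shows "matrix_inv H $ m $ k =
    det (\<chi> i j. if j = m then (if i = k then 1 else 0) else H $ i $ j) * inverse (det H)"
proof -
  have "H *v column k (matrix_inv H) = (\<chi> i. if i = k then 1 else 0)"
    using assms(2) by (simp add: vec_eq_iff matrix_vector_mult_def column_def matrix_matrix_mult_def mat_def)
  then have "column k (matrix_inv H) = (\<chi> m. det (\<chi> i j. if j = m then (\<chi> i. if i = k then 1 else 0) $ i else H $ i $ j) / det H)"
    using cramer[of H] assms(1) by (simp add: invertible_det_nz)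
  then show ?thesis
    by (simp add: column_def vec_eq_iff divide_inverse cong: if_cong)
qed


section \<open>The Chern-Finsler connection in a chart\<close>

text \<open>The manifold enters the local argument only through these four facts, with Z the image
  of a chart. \<open>L_scale\<close> stays off the zero section, as smoothness does.\<close>

locale local_finsler =
  fixes Z :: "(complex^'n::finite) set"
    and L :: "(complex^'n) \<times> (complex^'n) \<Rightarrow> real"
  assumes open_Z: "open Z"
    and smooth_L: "C_infinity_on (Z \<times> (UNIV - {0})) L"
    and L_scale: "z \<in> Z \<Longrightarrow> \<eta> \<noteq> 0 \<Longrightarrow> a \<noteq> 0 \<Longrightarrow> L (z, a *s \<eta>) = (cmod a)\<^sup>2 * L (z, \<eta>)"
    and pos_def: "x \<in> Z \<times> (UNIV - {0}) \<Longrightarrow> hermitian_pos_def (g_mat L x)"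
begin

abbreviation S :: "((complex^'n) \<times> (complex^'n)) set" where "S \<equiv> Z \<times> (UNIV - {0})"
abbreviation f :: "(complex^'n) \<times> (complex^'n) \<Rightarrow> complex" where "f \<equiv> \<lambda>y. complex_of_real (L y)"
text \<open>The barred index is the second one of g but the first one of h; all contractions below
  follow this order.\<close>

abbreviation g :: "'n \<Rightarrow> 'n \<Rightarrow> (complex^'n) \<times> (complex^'n) \<Rightarrow> complex" where "g i j \<equiv> \<lambda>y. g_mat L y $ i $ j"
abbreviation h :: "'n \<Rightarrow> 'n \<Rightarrow> (complex^'n) \<times> (complex^'n) \<Rightarrow> complex" where "h i j \<equiv> \<lambda>y. g_inv L y $ i $ j"
abbreviation N :: "'n \<Rightarrow> 'n \<Rightarrow> (complex^'n) \<times> (complex^'n) \<Rightarrow> complex" where "N \<equiv> N_coeff L"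
abbreviation \<Gamma> :: "'n \<Rightarrow> 'n \<Rightarrow> 'n \<Rightarrow> (complex^'n) \<times> (complex^'n) \<Rightarrow> complex" where "\<Gamma> \<equiv> L_coeff L"
abbreviation G :: "'n \<Rightarrow> (complex^'n) \<times> (complex^'n) \<Rightarrow> complex" where "G \<equiv> G_spray L"
abbreviation eta :: "'n \<Rightarrow> (complex^'n) \<times> (complex^'n) \<Rightarrow> complex" where "eta l \<equiv> \<lambda>y. snd y $ l"
abbreviation eta_bar :: "'n \<Rightarrow> (complex^'n) \<times> (complex^'n) \<Rightarrow> complex" where "eta_bar l \<equiv> \<lambda>y. cnj (snd y $ l)"

section \<open>Smoothness of the connection coefficients\<close>

lemma open_S: "open S"
  by (intro open_Times open_Z) auto

lemma smooth_eta: "C_infinity_on S (eta l)" "C_infinity_on S (eta_bar l)"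
  by (rule C_infinity_on_bounded_linear[OF bounded_linear_eta] C_infinity_on_bounded_linear[OF bounded_linear_eta_bar])+

lemma smooth_f: "C_infinity_on S f"
  using C_infinity_on_compose_bounded_linear[OF open_S bounded_linear_of_real smooth_L] .

lemma smooth_d:
  assumes "C_infinity_on S u"
  shows "C_infinity_on S (d_z k u)" "C_infinity_on S (d_eta k u)" "C_infinity_on S (d_eta_bar k u)"
  by (rule is_wirtinger_d[THEN is_wirtinger_C_infinity[OF _ open_S assms]])+

lemma g_eq: "g i j x = d_eta i (d_eta_bar j f) x"
  by (simp add: g_mat_def)

lemma smooth_g: "C_infinity_on S (g i j)"
  unfolding g_eq by (intro smooth_d smooth_f)

lemma g_inverse:
  assumes "x \<in> S"
  shows "(\<Sum>m\<in>UNIV. g i m x * h m j x) = (if i = j then 1 else 0)"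
    "(\<Sum>m\<in>UNIV. h i m x * g m j x) = (if i = j then 1 else 0)"
  using matrix_inv_works(1,2)[OF pos_def[OF assms]]
  by (simp_all add: g_inv_def matrix_matrix_mult_def mat_def vec_eq_iff)

lemma smooth_h: "C_infinity_on S (h m k)"
proof -
  \<comment> \<open>The numerator in Cramer's rule: column m of g is replaced by the k-th unit
    vector. The denominator det g does not vanish on S.\<close>
  define M where "M = (\<lambda>x. \<chi> i j. if j = m then (if i = k then 1 else 0) else g i j x)"
  have "C_infinity_on S (\<lambda>x. M x $ i $ j)" for i j
    by (cases "j = m") (simp_all add: M_def C_infinity_on_const smooth_g)
  then have "C_infinity_on S (\<lambda>x. det (M x) * inverse (det (g_mat L x)))"
    using matrix_inv_works(3)[OF pos_def]
    by (intro C_infinity_on_mult C_infinity_on_inverse C_infinity_on_det open_S smooth_g)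
      (simp_all add: invertible_det_nz)
  then show ?thesis
    by (rule C_infinity_on_cong[OF open_S, rotated])
      (simp add: g_inv_def M_def matrix_inv_cramer matrix_inv_works pos_def)
qed

lemma smooth_N: "C_infinity_on S (N i j)"
  unfolding N_coeff_def[abs_def]
  by (intro C_infinity_on_sum C_infinity_on_mult open_S smooth_h smooth_d smooth_g smooth_eta)

lemma smooth_G: "C_infinity_on S (G i)"
  unfolding G_spray_def[abs_def]
  by (intro C_infinity_on_sum C_infinity_on_mult C_infinity_on_const open_S smooth_N smooth_eta)

lemma smooth_\<Gamma>: "C_infinity_on S (\<Gamma> i j k)"
  unfolding L_coeff_def[abs_def] delta_def[abs_def]
  by (intro C_infinity_on_sum C_infinity_on_mult C_infinity_on_diff open_S smooth_N smooth_h smooth_d smooth_g)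

lemmas smooth = smooth_f smooth_g smooth_h smooth_N smooth_G smooth_\<Gamma> smooth_eta smooth_d

lemma diff: "x \<in> S \<Longrightarrow> C_infinity_on S u \<Longrightarrow> u differentiable (at x)"
  using C_infinity_on_differentiable .

lemma d_sum_mult:
  assumes "is_wirtinger D" "x \<in> S" "\<And>i. C_infinity_on S (u i)" "\<And>i. C_infinity_on S (v i)"
  shows "D (\<lambda>y. \<Sum>i\<in>(UNIV::'n set). u i y * v i y) x = (\<Sum>i\<in>UNIV. u i x * D (v i) x + D (u i) x * v i x)"
  by (rule is_wirtinger_sum_mult[OF assms(1)]) (auto intro: diff assms)

lemma d_cong:
  assumes "is_wirtinger D" "x \<in> S" "\<And>y. y \<in> S \<Longrightarrow> u y = v y"
  shows "D u x = D v x"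
  by (rule is_wirtinger_cong[OF assms(1) open_S assms(2,3)])

lemma d_commute:
  assumes "is_wirtinger D" "is_wirtinger E" "x \<in> S" "C_infinity_on S u"
  shows "D (E u) x = E (D u) x"
  by (rule is_wirtinger_commute[OF assms(1,2) open_S assms(3,4)])

section \<open>Homogeneity and Euler relations\<close>

lemma f_radial_derivative:
  assumes "x \<in> S"
  shows "dirD (0, w *s snd x) f x = of_real (2 * Re w) * f x"
proof -
  obtain z \<eta> where x: "x = (z, \<eta>)" "z \<in> Z" "\<eta> \<noteq> 0"
    using assms by auto
  \<comment> \<open>The derivative at t = 0 of f at (z, (1 + t w) \<eta>) is found twice: here by
    the chain rule, then from |1 + t w|^2 L, a quadratic polynomial in t with linear coefficient 2
    Re(w) L.\<close>
  have "((\<lambda>t. f (x + t *\<^sub>R (0, w *s \<eta>))) has_vector_derivative dirD (0, w *s \<eta>) f (x + 0 *\<^sub>R (0, w *s \<eta>))) (at 0)"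
    by (rule has_vector_derivative_along_line) (simp add: diff[OF assms smooth_f] flip: zero_prod_def)
  then have 1: "((\<lambda>t. f (x + t *\<^sub>R (0, w *s \<eta>))) has_vector_derivative dirD (0, w *s \<eta>) f x) (at 0)"
    by (simp flip: zero_prod_def)
  have "((\<lambda>t. complex_of_real (((1 + t * Re w)\<^sup>2 + (t * Im w)\<^sup>2) * L x)) has_vector_derivative of_real (2 * Re w * L x)) (at 0)"
    by (rule has_vector_derivative_of_real)
      (auto intro!: derivative_eq_intros simp: has_real_derivative_iff_has_vector_derivative[symmetric])
  \<comment> \<open>\<open>L_scale\<close> asks for a nonzero factor, so t is confined to an open
    set around 0 where 1 + t w does not vanish.\<close>
  moreover have "open {t. 1 + of_real t * w \<noteq> 0}"
    by (intro open_Collect_neq continuous_intros)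
  moreover have "0 \<in> {t. 1 + of_real t * w \<noteq> 0}" by simp
  moreover have "complex_of_real (((1 + t * Re w)\<^sup>2 + (t * Im w)\<^sup>2) * L x) = f (x + t *\<^sub>R (0, w *s \<eta>))"
    if "t \<in> {t. 1 + of_real t * w \<noteq> 0}" for t
  proof -
    have "x + t *\<^sub>R (0, w *s \<eta>) = (z, (1 + of_real t * w) *s \<eta>)"
      by (simp add: x vec_eq_iff algebra_simps scaleR_conv_of_real[of _ "_::complex"])
    then show ?thesis
      using that x L_scale[of z \<eta> "1 + of_real t * w"] by (simp add: cmod_power2)
  qed
  ultimately have "((\<lambda>t. f (x + t *\<^sub>R (0, w *s \<eta>))) has_vector_derivative of_real (2 * Re w * L x)) (at 0)"
    by (rule has_vector_derivative_transform_within_open)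
  with 1 show ?thesis
    using x by (auto dest: vector_derivative_unique_at)
qed

text \<open>L has degree 1 in \<eta> and degree 1 in its conjugate. The radial factors w = 1 and w =
  i separate the two relations: they give P + Q = 2 f and P = Q.\<close>

lemma euler_f:
  assumes "x \<in> S"
  shows "(\<Sum>l\<in>UNIV. eta l x * d_eta l f x) = f x"
    "(\<Sum>l\<in>UNIV. eta_bar l x * d_eta_bar l f x) = f x"
proof -
  define P where "P = (\<Sum>l\<in>UNIV. eta l x * d_eta l f x)"
  define Q where "Q = (\<Sum>l\<in>UNIV. eta_bar l x * d_eta_bar l f x)"
  have *: "w * P + cnj w * Q = of_real (2 * Re w) * f x" for w
    unfolding f_radial_derivative[OF assms, symmetric] dirD_eta_decomposition[OF diff[OF assms smooth_f]]
    by (simp add: P_def Q_def sum.distrib sum_distrib_left mult.assoc)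
  have "P + Q = 2 * f x" "P = Q"
    using *[of 1] *[of \<i>] by (simp_all flip: right_diff_distrib)
  then have "P = f x" "Q = f x" by auto
  then show "(\<Sum>l\<in>UNIV. eta l x * d_eta l f x) = f x"
    "(\<Sum>l\<in>UNIV. eta_bar l x * d_eta_bar l f x) = f x"
    by (simp_all add: P_def Q_def)
qed

lemma g_sym:
  assumes "x \<in> S"
  shows "d_eta k (g i j) x = d_eta i (g k j) x"
  unfolding g_eq by (rule d_commute) (simp_all add: assms smooth)

text \<open>Differentiate the first Euler relation in \<eta>-bar; the factor \<eta> is holomorphic,
  so only \<open>d_eta l f\<close> is hit.\<close>

lemma g_eta:
  assumes "x \<in> S"
  shows "(\<Sum>l\<in>UNIV. eta l x * g l m x) = d_eta_bar m f x"
proof -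
  have "d_eta_bar m f x = d_eta_bar m (\<lambda>y. \<Sum>l\<in>UNIV. eta l y * d_eta l f y) x"
    by (rule d_cong) (simp_all add: assms euler_f)
  also have "\<dots> = (\<Sum>l\<in>UNIV. eta l x * d_eta_bar m (d_eta l f) x)"
    by (subst d_sum_mult) (simp_all add: assms smooth d_eta_coordinate)
  also have "\<dots> = (\<Sum>l\<in>UNIV. eta l x * g l m x)"
    unfolding g_eq by (subst d_commute) (simp_all add: assms smooth)
  finally show ?thesis by simp
qed

lemma g_eta_bar:
  assumes "x \<in> S"
  shows "(\<Sum>m\<in>UNIV. eta_bar m x * g i m x) = d_eta i f x"
proof -
  have "d_eta i f x = d_eta i (\<lambda>y. \<Sum>l\<in>UNIV. eta_bar l y * d_eta_bar l f y) x"
    by (rule d_cong) (simp_all add: assms euler_f)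
  also have "\<dots> = (\<Sum>l\<in>UNIV. eta_bar l x * g i l x)"
    by (subst d_sum_mult) (simp_all add: assms smooth d_eta_coordinate g_eq)
  finally show ?thesis by simp
qed

text \<open>Applying \<open>d_eta j\<close> to \<open>g_eta\<close> produces g j m on both sides, so
  the remaining sum vanishes. Through \<open>g_sym\<close> this says that g has degree 0 in
  \<eta>.\<close>

lemma euler_g:
  assumes "x \<in> S"
  shows "(\<Sum>l\<in>UNIV. eta l x * d_eta j (g l m) x) = 0"
proof -
  have "g j m x = d_eta j (\<lambda>y. \<Sum>l\<in>UNIV. eta l y * g l m y) x"
    unfolding g_eq by (rule d_cong) (simp_all add: assms g_eta[unfolded g_eq])
  also have "\<dots> = (\<Sum>l\<in>UNIV. eta l x * d_eta j (g l m) x) + g j m x"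
    by (subst d_sum_mult[OF is_wirtinger_d(2)])
      (simp_all add: assms smooth d_eta_coordinate sum.distrib if_distrib[of "\<lambda>c. c * _"] if_distrib[of "\<lambda>c. _ * c"] cong: if_cong)
  finally show ?thesis by simp
qed

lemma d_z_g_eta:
  assumes "x \<in> S"
  shows "(\<Sum>l\<in>UNIV. eta l x * d_z k (g l m) x) = d_z k (d_eta_bar m f) x"
proof -
  have "d_z k (d_eta_bar m f) x = d_z k (\<lambda>y. \<Sum>l\<in>UNIV. eta l y * g l m y) x"
    by (rule d_cong) (simp_all add: assms g_eta)
  also have "\<dots> = (\<Sum>l\<in>UNIV. eta l x * d_z k (g l m) x)"
    by (subst d_sum_mult) (simp_all add: assms smooth d_eta_coordinate)
  finally show ?thesis by simp
qed

lemma d_z_eta_bar: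
  assumes "x \<in> S"
  shows "(\<Sum>m\<in>UNIV. eta_bar m x * d_z k (d_eta_bar m f) x) = d_z k f x"
proof -
  have "d_z k f x = d_z k (\<lambda>y. \<Sum>l\<in>UNIV. eta_bar l y * d_eta_bar l f y) x"
    by (rule d_cong) (simp_all add: assms euler_f)
  also have "\<dots> = (\<Sum>l\<in>UNIV. eta_bar l x * d_z k (d_eta_bar l f) x)"
    by (subst d_sum_mult) (simp_all add: assms smooth d_eta_coordinate)
  finally show ?thesis by simp
qed

section \<open>Index calculus and the connection coefficients\<close>

lemma lower_index:
  assumes "x \<in> S"
  shows "(\<Sum>i\<in>UNIV. g i m x * (\<Sum>l\<in>UNIV. h l i x * u l)) = u m"
proof -
  have "(\<Sum>i\<in>UNIV. g i m x * (\<Sum>l\<in>UNIV. h l i x * u l)) = (\<Sum>l\<in>UNIV. (\<Sum>i\<in>UNIV. h l i x * g i m x) * u l)"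
    unfolding sum_distrib_left sum_distrib_right by (subst sum.swap) (simp add: ac_simps)
  also have "\<dots> = u m"
    by (simp add: g_inverse[OF assms] if_distrib[of "\<lambda>c. c * _"] cong: if_cong)
  finally show ?thesis .
qed

lemma raise_index:
  assumes "x \<in> S" "\<And>m. (\<Sum>i\<in>UNIV. g i m x * v i) = u m"
  shows "v i = (\<Sum>l\<in>UNIV. h l i x * u l)"
proof -
  have "(\<Sum>l\<in>UNIV. h l i x * u l) = (\<Sum>k\<in>UNIV. (\<Sum>l\<in>UNIV. g k l x * h l i x) * v k)"
    unfolding assms(2)[symmetric] sum_distrib_left sum_distrib_right by (subst sum.swap) (simp add: ac_simps)
  also have "\<dots> = v i"
    by (simp add: g_inverse[OF assms(1)] if_distrib[of "\<lambda>c. c * _"] cong: if_cong)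
  finally show ?thesis by simp
qed

lemma N_eq:
  assumes "x \<in> S"
  shows "N i k x = (\<Sum>l\<in>UNIV. h l i x * d_z k (d_eta_bar l f) x)"
  unfolding d_z_g_eta[OF assms, symmetric] N_coeff_def
  by (simp add: sum_distrib_left ac_simps)

lemma g_N:
  assumes "x \<in> S"
  shows "(\<Sum>i\<in>UNIV. g i m x * N i k x) = d_z k (d_eta_bar m f) x"
  by (simp add: N_eq assms lower_index)

text \<open>Apply \<open>d_eta j\<close> to \<open>g_N\<close>. By \<open>g_sym\<close>, the terms
  in which the derivative hits g are exactly the correction that \<open>delta\<close> subtracts from
  the z-derivative of g. What is left is a linear system with matrix g, solved by
  \<open>raise_index\<close>.\<close>

lemma \<Gamma>_eq_d_eta_N:
  assumes "x \<in> S"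
  shows "\<Gamma> i j k x = d_eta j (N i k) x"
proof -
  have "(\<Sum>i\<in>UNIV. g i m x * d_eta j (N i k) x) = delta L k (g j m) x" for m
  proof -
    have "d_z k (g j m) x = d_eta j (\<lambda>y. d_z k (d_eta_bar m f) y) x"
      unfolding g_eq by (rule d_commute) (simp_all add: assms smooth)
    also have "\<dots> = d_eta j (\<lambda>y. \<Sum>i\<in>UNIV. g i m y * N i k y) x"
      by (rule d_cong) (simp_all add: assms g_N)
    also have "\<dots> = (\<Sum>i\<in>UNIV. g i m x * d_eta j (N i k) x) + (\<Sum>i\<in>UNIV. d_eta i (g j m) x * N i k x)"
      by (subst d_sum_mult[OF is_wirtinger_d(2)]) (simp_all add: assms smooth sum.distrib g_sym[OF assms, of j])
    finally show ?thesis
      by (simp add: delta_def ac_simps)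
  qed
  from raise_index[OF assms this] show ?thesis
    by (simp add: L_coeff_def)
qed

text \<open>Contracting the first lower index with \<eta> kills the correction term of
  \<open>delta\<close> by \<open>euler_g\<close>, so only the z-derivative of g survives.\<close>

lemma \<Gamma>_eta:
  assumes "x \<in> S"
  shows "(\<Sum>j\<in>UNIV. \<Gamma> i j k x * eta j x) = N i k x"
proof -
  have "(\<Sum>j\<in>UNIV. eta j x * delta L k (g j m) x) = d_z k (d_eta_bar m f) x" for m
  proof -
    have "(\<Sum>j\<in>UNIV. eta j x * delta L k (g j m) x) = (\<Sum>j\<in>UNIV. eta j x * d_z k (g j m) x)
       - (\<Sum>l\<in>UNIV. N l k x * (\<Sum>j\<in>UNIV. eta j x * d_eta l (g j m) x))"
      unfolding delta_def right_diff_distrib sum_subtractf sum_distrib_left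
      by (subst (2) sum.swap) (simp add: ac_simps)
    then show ?thesis
      by (simp add: euler_g assms d_z_g_eta)
  qed
  then have "N i k x = (\<Sum>l\<in>UNIV. h l i x * (\<Sum>j\<in>UNIV. eta j x * delta L k (g j l) x))"
    by (simp add: N_eq assms)
  also have "\<dots> = (\<Sum>j\<in>UNIV. \<Gamma> i j k x * eta j x)"
    unfolding L_coeff_def sum_distrib_left sum_distrib_right by (subst sum.swap) (simp add: ac_simps)
  finally show ?thesis by simp
qed

text \<open>Here \<eta> meets the last lower index. The product rule for \<open>d_eta k\<close>
  applied to the sum defining 2 G gives this contraction plus N.\<close>

lemma \<Gamma>_eta':
  assumes "x \<in> S"
  shows "(\<Sum>j\<in>UNIV. \<Gamma> i k j x * eta j x) = 2 * d_eta k (G i) x - N i k x"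
proof -
  have "d_eta k (\<lambda>y. \<Sum>j\<in>UNIV. N i j y * eta j y) x = (\<Sum>j\<in>UNIV. \<Gamma> i k j x * eta j x) + N i k x"
    by (subst d_sum_mult[OF is_wirtinger_d(2)])
      (simp_all add: assms smooth d_eta_coordinate sum.distrib \<Gamma>_eq_d_eta_N if_distrib[of "\<lambda>c. c * _"] if_distrib[of "\<lambda>c. _ * c"] cong: if_cong)
  moreover have "d_eta k (G i) x = 1/2 * d_eta k (\<lambda>y. \<Sum>j\<in>UNIV. N i j y * eta j y) x"
    unfolding G_spray_def[abs_def]
    using assms by (subst is_wirtinger_mult)
      (auto intro!: diff C_infinity_on_const C_infinity_on_sum C_infinity_on_mult smooth open_S simp: is_wirtinger_const)
  ultimately show ?thesis by (simp add: eq_diff_eq mult.commute)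
qed

text \<open>The difference of the two contractions just computed. It turns the Kaehler condition
  into the equality of N with the \<eta>-derivative of G.\<close>

lemma torsion_eta:
  assumes "x \<in> S"
  shows "(\<Sum>j\<in>UNIV. T_torsion L i j k x * eta j x) = 2 * (N i k x - d_eta k (G i) x)"
  using \<Gamma>_eta[OF assms, of i k] \<Gamma>_eta'[OF assms, of i k]
  by (simp add: T_torsion_def left_diff_distrib sum_subtractf)

text \<open>Differentiating \<open>\<Gamma>_eta\<close> along \<eta>^j and cancelling \<Gamma>
  leaves a sum with j and l in the wrong places. They may be exchanged because \<Gamma> is itself an
  \<eta>-derivative of N and second derivatives commute.\<close>

lemma euler_\<Gamma>:
  assumes "x \<in> S"
  shows "(\<Sum>l\<in>UNIV. eta l x * d_eta l (\<Gamma> i j k) x) = 0"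
proof -
  have "\<Gamma> i j k x = d_eta j (\<lambda>y. \<Sum>l\<in>UNIV. \<Gamma> i l k y * eta l y) x"
    unfolding \<Gamma>_eq_d_eta_N[OF assms] by (rule d_cong) (simp_all add: assms \<Gamma>_eta)
  also have "\<dots> = (\<Sum>l\<in>UNIV. eta l x * d_eta j (\<Gamma> i l k) x) + \<Gamma> i j k x"
    by (subst d_sum_mult[OF is_wirtinger_d(2)]) (simp_all add: assms smooth d_eta_coordinate sum.distrib if_distrib[of "\<lambda>c. c * _"] if_distrib[of "\<lambda>c. _ * c"] ac_simps cong: if_cong)
  also have "(\<Sum>l\<in>UNIV. eta l x * d_eta j (\<Gamma> i l k) x) = (\<Sum>l\<in>UNIV. eta l x * d_eta l (\<Gamma> i j k) x)"
  proof (intro sum.cong refl arg_cong2[of _ _ _ _ "(*)"])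
    fix l
    have "d_eta j (\<Gamma> i l k) x = d_eta j (d_eta l (N i k)) x"
      by (rule d_cong) (simp_all add: assms \<Gamma>_eq_d_eta_N)
    also have "\<dots> = d_eta l (d_eta j (N i k)) x"
      by (rule d_commute) (simp_all add: assms smooth)
    also have "\<dots> = d_eta l (\<Gamma> i j k) x"
      by (rule d_cong) (simp_all add: assms \<Gamma>_eq_d_eta_N)
    finally show "d_eta j (\<Gamma> i l k) x = d_eta l (\<Gamma> i j k) x" .
  qed
  finally show ?thesis by simp
qed

section \<open>Holomorphy of the spray when \<Gamma> depends on z only\<close>

lemma dirD_eta_zero_of_constant:
  assumes "x \<in> S" "u differentiable (at x)" "\<And>\<eta>. \<eta> \<noteq> 0 \<Longrightarrow> u (fst x, \<eta>) = u x"
  shows "dirD (0, v) u x = 0"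
proof -
  have "((\<lambda>t. u (x + t *\<^sub>R (0, v))) has_vector_derivative dirD (0, v) u (x + 0 *\<^sub>R (0, v))) (at 0)"
    by (rule has_vector_derivative_along_line) (simp add: assms(2) flip: zero_prod_def)
  moreover have "((\<lambda>t. u (x + t *\<^sub>R (0, v))) has_vector_derivative 0) (at 0)"
  proof (rule has_vector_derivative_transform_within_open)
    show "((\<lambda>t. u x) has_vector_derivative 0) (at 0)" by simp
    \<comment> \<open>Constancy is assumed off the zero section only, so t must avoid the points
      where the line meets 0.\<close>
    show "open {t. snd x + t *\<^sub>R v \<noteq> 0}"
      by (intro open_Collect_neq continuous_intros)
  qed (use assms in \<open>auto simp: prod_eq_iff plus_prod_def\<close>)
  ultimately show ?thesis
    by (auto dest: vector_derivative_unique_at simp flip: zero_prod_def)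
qed

text \<open>Two contractions with the holomorphic \<eta>, first \<open>\<Gamma>_eta\<close> and then
  the definition of G, carry the vanishing of \<eta>-bar derivatives from \<Gamma> to N and on to
  G.\<close>

lemma G_holomorphic_of_constant_\<Gamma>:
  assumes x: "x \<in> S"
    and const: "\<And>z \<eta> \<eta>' i j k. z \<in> Z \<Longrightarrow> \<eta> \<noteq> 0 \<Longrightarrow> \<eta>' \<noteq> 0 \<Longrightarrow> \<Gamma> i j k (z, \<eta>) = \<Gamma> i j k (z, \<eta>')"
  shows "d_eta_bar m (G i) x = 0"
proof -
  have \<Gamma>0: "d_eta_bar m (\<Gamma> i j k) x = 0" for j k
  proof -
    have "dirD (0, v) (\<Gamma> i j k) x = 0" for v
    proof (rule dirD_eta_zero_of_constant[OF x diff[OF x smooth_\<Gamma>]])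
      show "\<Gamma> i j k (fst x, \<eta>) = \<Gamma> i j k x" if "\<eta> \<noteq> 0" for \<eta>
        using const[of "fst x" \<eta> "snd x"] x that by (simp add: mem_Times_iff)
    qed
    then show ?thesis by (simp add: d_eta_bar_def)
  qed
  have N0: "d_eta_bar m (N i k) x = 0" for k
  proof -
    have "d_eta_bar m (N i k) x = d_eta_bar m (\<lambda>y. \<Sum>j\<in>UNIV. \<Gamma> i j k y * eta j y) x"
      by (rule d_cong) (simp_all add: x \<Gamma>_eta)
    also have "\<dots> = 0"
      by (subst d_sum_mult) (simp_all add: x smooth d_eta_coordinate \<Gamma>0)
    finally show ?thesis .
  qed
  have "d_eta_bar m (\<lambda>y. \<Sum>j\<in>UNIV. N i j y * eta j y) x = 0"
    by (subst d_sum_mult) (simp_all add: x smooth d_eta_coordinate N0)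
  then show ?thesis
    unfolding G_spray_def[abs_def]
    using x by (subst is_wirtinger_mult)
      (auto intro!: diff C_infinity_on_const C_infinity_on_sum C_infinity_on_mult smooth open_S simp: is_wirtinger_const)
qed

section \<open>From weakly Kaehler to Kaehler\<close>

lemma N_eq_d_eta_G:
  assumes x: "x \<in> S"
    and wk: "\<And>x k. x \<in> S \<Longrightarrow> (\<Sum>i\<in>UNIV. \<Sum>l\<in>UNIV. \<Sum>j\<in>UNIV.
           g_mat L x $ i $ l * T_torsion L i j k x * snd x $ j * cnj (snd x $ l)) = 0"
    and hol: "\<And>x i m. x \<in> S \<Longrightarrow> d_eta_bar m (G i) x = 0"
  shows "N i k x = d_eta k (G i) x"
proof -
  \<comment> \<open>By \<open>torsion_eta\<close> the weak condition contracts N minus the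
    derivative of G with g and \<eta>-bar. On the G side \<open>g_eta_bar\<close> turns this into
    derivatives of f; on the N side \<open>g_N\<close> and \<open>d_z_eta_bar\<close> give the
    z-derivative of f.\<close>
  have *: "d_z k f y = (\<Sum>i\<in>UNIV. d_eta i f y * d_eta k (G i) y)" if y: "y \<in> S" for y k
  proof -
    have "0 = (\<Sum>i\<in>UNIV. \<Sum>l\<in>UNIV. g i l y * eta_bar l y * (\<Sum>j\<in>UNIV. T_torsion L i j k y * eta j y))"
      unfolding wk[OF y, of k, symmetric] sum_distrib_left by (simp add: ac_simps)
    also have "\<dots> = (\<Sum>i\<in>UNIV. \<Sum>l\<in>UNIV. 2 * (eta_bar l y * g i l y * N i k y))
       - (\<Sum>i\<in>UNIV. \<Sum>l\<in>UNIV. 2 * (eta_bar l y * g i l y * d_eta k (G i) y))"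
      unfolding torsion_eta[OF y] sum_subtractf[symmetric]
      by (intro sum.cong refl) (simp add: algebra_simps)
    also have "(\<Sum>i\<in>UNIV. \<Sum>l\<in>UNIV. 2 * (eta_bar l y * g i l y * d_eta k (G i) y))
      = 2 * (\<Sum>i\<in>UNIV. d_eta i f y * d_eta k (G i) y)"
      unfolding g_eta_bar[OF y, symmetric] by (simp add: sum_distrib_left sum_distrib_right)
    also have "(\<Sum>i\<in>UNIV. \<Sum>l\<in>UNIV. 2 * (eta_bar l y * g i l y * N i k y))
      = 2 * (\<Sum>l\<in>UNIV. eta_bar l y * (\<Sum>i\<in>UNIV. g i l y * N i k y))"
      by (subst sum.swap) (simp add: sum_distrib_left ac_simps)
    also have "\<dots> = 2 * d_z k f y"
      by (simp add: g_N y d_z_eta_bar)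
    finally show ?thesis by simp
  qed
  have GG: "d_eta_bar m (d_eta k (G i)) x = 0" for i m
  proof -
    have "d_eta_bar m (d_eta k (G i)) x = d_eta k (d_eta_bar m (G i)) x"
      by (rule d_commute) (simp_all add: x smooth)
    also have "\<dots> = d_eta k (\<lambda>y. 0) x"
      by (rule d_cong) (simp_all add: x hol)
    finally show ?thesis by (simp add: is_wirtinger_const)
  qed
  \<comment> \<open>Differentiating the previous identity in \<eta>-bar shows that the derivatives
    of G solve the same linear system as N in \<open>g_N\<close>; invertibility of g then identifies
    them.\<close>
  have "(\<Sum>i\<in>UNIV. g i m x * d_eta k (G i) x) = d_z k (d_eta_bar m f) x" for m
  proof -
    have "d_z k (d_eta_bar m f) x = d_eta_bar m (d_z k f) x"
      by (rule d_commute) (simp_all add: x smooth)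
    also have "\<dots> = d_eta_bar m (\<lambda>y. \<Sum>i\<in>UNIV. d_eta i f y * d_eta k (G i) y) x"
      by (rule d_cong) (simp_all add: x *)
    also have "\<dots> = (\<Sum>i\<in>UNIV. d_eta_bar m (d_eta i f) x * d_eta k (G i) x)"
      by (subst d_sum_mult) (simp_all add: x smooth GG)
    also have "\<dots> = (\<Sum>i\<in>UNIV. g i m x * d_eta k (G i) x)"
      unfolding g_eq by (subst d_commute) (simp_all add: x smooth)
    finally show ?thesis by simp
  qed
  from raise_index[OF x this, of i] show ?thesis
    by (simp add: N_eq x)
qed

section \<open>Liouville argument along complex lines\<close>

lemma complex_line_derivative:
  assumes "u differentiable (at (z, a + t *s b))" "\<And>m. d_eta_bar m u (z, a + t *s b) = 0"
  shows "((\<lambda>t. u (z, a + t *s b)) has_field_derivative (\<Sum>l\<in>UNIV. b $ l * d_eta l u (z, a + t *s b))) (at t)"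
proof -
  have "linear (\<lambda>w. w *s b)"
    by (intro linearI) (simp_all add: vec_eq_iff algebra_simps)
  then have "bounded_linear (\<lambda>w. w *s b)"
    by (simp add: linear_conv_bounded_linear)
  then have "((\<lambda>t. (z, a + t *s b)) has_derivative (\<lambda>w. (0, w *s b))) (at t)"
    using bounded_linear_imp_has_derivative by (auto intro!: derivative_eq_intros)
  from has_derivative_compose[OF this frechet_derivative_works[THEN iffD1, OF assms(1)]]
  \<comment> \<open>With the \<eta>-bar terms gone, the real differential along the line is
    multiplication by a single complex number.\<close>
  show ?thesis
    unfolding has_field_derivative_def dirD_eta_decomposition[OF assms(1)]
    by (rule has_derivative_eq_rhs) (simp add: assms(2) fun_eq_iff sum_distrib_left sum_distrib_right ac_simps)
qed

text \<open>If a is a multiple of b, degree 0 homogeneity suffices. Otherwise the line a + t b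
  misses the origin, and u(a + t b) = u(a/t + b) tends to u(b) as t grows, so Liouville's theorem
  applies.\<close>

lemma constant_of_holomorphic_homogeneous:
  assumes smooth_u: "C_infinity_on S u"
    and hol: "\<And>x m. x \<in> S \<Longrightarrow> d_eta_bar m u x = 0"
    and euler: "\<And>x. x \<in> S \<Longrightarrow> (\<Sum>l\<in>UNIV. eta l x * d_eta l u x) = 0"
    and z: "z \<in> Z" and ab: "a \<noteq> 0" "b \<noteq> 0"
  shows "u (z, a) = u (z, b)"
proof -
  \<comment> \<open>The Euler relation is infinitesimal; it integrates to invariance under scaling
    because the punctured plane is connected.\<close>
  have scale: "u (z, c *s v) = u (z, v)" if "c \<noteq> 0" "v \<noteq> 0" for c v
  proof -
    have der: "((\<lambda>t. u (z, t *s v)) has_field_derivative 0) (at t)" if "t \<noteq> 0" for t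
    proof -
      have "(z, 0 + t *s v) \<in> S" using z \<open>v \<noteq> 0\<close> that by simp
      from complex_line_derivative[OF diff[OF this smooth_u] hol[OF this]] euler[OF this]
      show ?thesis
        using that by (simp add: mult.assoc flip: sum_distrib_left)
    qed
    have "connected (- {0::complex})"
      by (intro connected_punctured_universe) simp
    moreover have "continuous_on (- {0}) (\<lambda>t. u (z, t *s v))"
      using der by (auto intro!: continuous_at_imp_continuous_on DERIV_isCont)
    ultimately obtain k where k: "\<And>t. t \<in> - {0} \<Longrightarrow> u (z, t *s v) = k"
      using DERIV_zero_connected_constant[of "- {0}" "{}" "\<lambda>t. u (z, t *s v)"] der by auto
    show ?thesis
      using k[of c] k[of 1] that by simp
  qed
  show ?thesis
  proof (cases "\<exists>c. a = c *s b")
    case True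
    then show ?thesis using scale ab by auto
  next
    case False
    have nz: "a + t *s b \<noteq> 0" for t
    proof
      assume "a + t *s b = 0"
      then have "a = (- t) *s b" by (simp add: eq_neg_iff_add_eq_0)
      with False show False by blast
    qed
    have "(\<lambda>t. u (z, a + t *s b)) holomorphic_on UNIV"
      unfolding holomorphic_on_def field_differentiable_def
    proof
      fix t
      have "(z, a + t *s b) \<in> S" using z nz by simp
      from has_field_derivative_at_within[OF complex_line_derivative[OF diff[OF this smooth_u] hol[OF this]]]
      show "\<exists>f'. ((\<lambda>t. u (z, a + t *s b)) has_field_derivative f') (at t within UNIV)" by blast
    qed
    moreover have "((\<lambda>t. u (z, a + t *s b)) \<longlongrightarrow> u (z, b)) at_infinity"
    proof -
      have "isCont u (z, b)"
        using diff[OF _ smooth_u] z ab by (intro differentiable_imp_continuous_within) auto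
      moreover have "((\<lambda>t. (z, inverse t *s a + b)) \<longlongrightarrow> (z, b)) at_infinity"
      proof -
        have "((\<lambda>t. \<chi> i. inverse t * a $ i + b $ i) \<longlongrightarrow> (\<chi> i. 0 * a $ i + b $ i)) at_infinity"
          by (intro tendsto_intros tendsto_inverse_0)
        moreover have "(\<lambda>t. \<chi> i. inverse t * a $ i + b $ i) = (\<lambda>t. inverse t *s a + b)" "(\<chi> i. 0 * a $ i + b $ i) = b"
          by (simp_all add: fun_eq_iff vec_eq_iff)
        ultimately show ?thesis by (intro tendsto_Pair) auto
      qed
      ultimately have "((\<lambda>t. u (z, inverse t *s a + b)) \<longlongrightarrow> u (z, b)) at_infinity"
        by (rule isCont_tendsto_compose)
      then show ?thesis
      proof (rule Lim_transform_eventually)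
        have "u (z, inverse t *s a + b) = u (z, a + t *s b)" if "t \<noteq> 0" for t
        proof -
          have "inverse t *s (a + t *s b) = inverse t *s a + b"
            using that by (simp add: vec_eq_iff field_simps)
          then show ?thesis using scale[of "inverse t" "a + t *s b"] nz that by simp
        qed
        moreover have "\<forall>\<^sub>F t::complex in at_infinity. t \<noteq> 0"
          unfolding eventually_at_infinity by (intro exI[of _ 1]) auto
        ultimately show "\<forall>\<^sub>F t in at_infinity. u (z, inverse t *s a + b) = u (z, a + t *s b)"
          by (auto elim: eventually_mono)
      qed
    qed
    \<comment> \<open>An entire function with a finite limit at infinity equals that limit
      everywhere, in particular at t = 0.\<close>
    ultimately have "u (z, a + 0 *s b) = u (z, b)"
      by (rule Liouville_weak)
    then show ?thesis by simp
  qed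
qed

text \<open>\<Gamma> is now a second \<eta>-derivative of G, so it inherits holomorphy by commuting
  derivatives; \<open>euler_\<Gamma>\<close> supplies degree 0.\<close>

lemma \<Gamma>_constant_of_weakly_kahler:
  assumes wk: "\<And>x k. x \<in> S \<Longrightarrow> (\<Sum>i\<in>UNIV. \<Sum>l\<in>UNIV. \<Sum>j\<in>UNIV.
           g_mat L x $ i $ l * T_torsion L i j k x * snd x $ j * cnj (snd x $ l)) = 0"
    and hol: "\<And>x i m. x \<in> S \<Longrightarrow> d_eta_bar m (G i) x = 0"
    and "z \<in> Z" "\<eta> \<noteq> 0" "\<eta>' \<noteq> 0"
  shows "\<Gamma> i j k (z, \<eta>) = \<Gamma> i j k (z, \<eta>')"
proof -
  note N = N_eq_d_eta_G[OF _ wk hol]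
  have "d_eta_bar m (\<Gamma> i j k) x = 0" if x: "x \<in> S" for x m
  proof -
    have "d_eta_bar m (\<Gamma> i j k) x = d_eta_bar m (d_eta j (N i k)) x"
      by (rule d_cong) (simp_all add: x \<Gamma>_eq_d_eta_N)
    also have "\<dots> = d_eta j (d_eta_bar m (N i k)) x"
      by (rule d_commute) (simp_all add: x smooth)
    also have "\<dots> = d_eta j (\<lambda>y. 0) x"
    proof (rule d_cong[OF is_wirtinger_d(2) x])
      fix y assume y: "y \<in> S"
      have "d_eta_bar m (N i k) y = d_eta_bar m (d_eta k (G i)) y"
        by (rule d_cong) (simp_all only: y N is_wirtinger_d)
      also have "\<dots> = d_eta k (d_eta_bar m (G i)) y"
        by (rule d_commute) (simp_all add: y smooth)
      also have "\<dots> = d_eta k (\<lambda>y. 0) y"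
        by (rule d_cong) (simp_all add: y hol)
      finally show "d_eta_bar m (N i k) y = 0" by (simp add: is_wirtinger_const)
    qed
    finally show ?thesis by (simp add: is_wirtinger_const)
  qed
  from constant_of_holomorphic_homogeneous[OF smooth_\<Gamma> this euler_\<Gamma> assms(3-5)]
  show ?thesis .
qed

end


section \<open>Charts of the holomorphic tangent bundle\<close>

lemma chart_inj_on:
  assumes "complex_manifold M A" "c \<in> A"
  shows "inj_on (snd c) (fst c)"
proof -
  have "fst c \<subseteq> topspace M"
    using assms openin_subset unfolding complex_manifold_def by blast
  then have "topspace (subtopology M (fst c)) = fst c"
    by auto
  then show ?thesis
    using assms unfolding complex_manifold_def homeomorphic_eq_everything_map by metis
qed

lemma open_chart_image:
  assumes "complex_manifold M A" "c \<in> A" "openin M U" "U \<subseteq> fst c"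
  shows "open (snd c ` U)"
proof -
  have "open_map (subtopology M (fst c)) (top_of_set (chart_image c)) (snd c)" and o: "open (chart_image c)"
    using assms(1,2) unfolding complex_manifold_def homeomorphic_eq_everything_map by blast+
  moreover have "openin (subtopology M (fst c)) U"
    using assms(3,4) by (metis inf.absorb1 openin_subtopology_Int)
  ultimately have "openin (top_of_set (chart_image c)) (snd c ` U)"
    unfolding open_map_def by blast
  then show ?thesis
    using o openin_open_eq by blast
qed

lemma transition_chart:
  assumes "complex_manifold M A" "c \<in> A" "p \<in> fst c"
  shows "transition c d (snd c p) = snd d p"
  using inv_into_f_f[OF chart_inj_on[OF assms(1,2)] assms(3)] by (simp add: transition_def)

lemma transition_differentiable:
  assumes "complex_manifold M A" "c \<in> A" "d \<in> A" "p \<in> fst c" "p \<in> fst d"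
  shows "transition c d differentiable (at (snd c p))"
    "frechet_derivative (transition c d) (at (snd c p)) (a *s v) =
      a *s frechet_derivative (transition c d) (at (snd c p)) v"
  using assms unfolding complex_manifold_def hol_map_on_def by blast+

lemma transition_derivative_cocycle:
  assumes M: "complex_manifold M A" and cde: "c \<in> A" "d \<in> A" "e \<in> A" "p \<in> fst c" "p \<in> fst d" "p \<in> fst e"
  shows "frechet_derivative (transition d e) (at (snd d p)) (frechet_derivative (transition c d) (at (snd c p)) v) =
    frechet_derivative (transition c e) (at (snd c p)) v"
proof -
  \<comment> \<open>The transition maps are total functions built from \<open>inv_into\<close>, and
    they compose as expected only over the triple overlap. Its image is open, so the chain rule can
    be transferred there.\<close>
  define W where "W = snd c ` (fst c \<inter> fst d \<inter> fst e)"
  have "openin M (fst c \<inter> fst d \<inter> fst e)"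
    using M cde unfolding complex_manifold_def by blast
  then have "open W"
    unfolding W_def by (rule open_chart_image[OF M cde(1)]) auto
  have "(transition c d has_derivative frechet_derivative (transition c d) (at (snd c p))) (at (snd c p))"
    using transition_differentiable(1)[OF M] cde frechet_derivative_works by blast
  moreover have "(transition d e has_derivative frechet_derivative (transition d e) (at (snd d p))) (at (transition c d (snd c p)))"
    using transition_differentiable(1)[OF M] cde frechet_derivative_works by (simp add: transition_chart[OF M]) blast
  ultimately have "((\<lambda>z. transition d e (transition c d z)) has_derivative
    (\<lambda>v. frechet_derivative (transition d e) (at (snd d p)) (frechet_derivative (transition c d) (at (snd c p)) v))) (at (snd c p))"
    by (rule has_derivative_compose)
  then have "(transition c e has_derivative
    (\<lambda>v. frechet_derivative (transition d e) (at (snd d p)) (frechet_derivative (transition c d) (at (snd c p)) v))) (at (snd c p))"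
    by (rule has_derivative_transform_within_open[OF _ \<open>open W\<close>])
      (use cde in \<open>auto simp: W_def transition_chart[OF M]\<close>)
  then show ?thesis
    by (simp add: frechet_derivative_eqI)
qed

lemma transition_derivative_self:
  assumes M: "complex_manifold M A" and c: "c \<in> A" "p \<in> fst c"
  shows "frechet_derivative (transition c c) (at (snd c p)) v = v"
proof -
  have "open (snd c ` fst c)"
    using M c unfolding complex_manifold_def chart_image_def by blast
  then have "(transition c c has_derivative (\<lambda>v. v)) (at (snd c p))"
    by (rule has_derivative_transform_within_open[OF has_derivative_ident])
      (use c in \<open>auto simp: transition_chart[OF M]\<close>)
  then show ?thesis
    by (simp add: frechet_derivative_eqI)
qed

section \<open>Lifting coordinates to tangent vectors\<close>

lemma tangent_vector_exists:
  assumes M: "complex_manifold M A" and c: "c \<in> A" "p \<in> fst c"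
  obtains v where "v \<in> hol_tangent_space A p" "v c = \<eta>"
proof -
  \<comment> \<open>The component \<eta> in c forces all others: push it forward by the transition
    derivatives and use 0 elsewhere, as \<open>hol_tangent_space\<close> demands. Compatibility is
    the cocycle rule.\<close>
  define v where "v = (\<lambda>d. if d \<in> A \<and> p \<in> fst d then frechet_derivative (transition c d) (at (snd c p)) \<eta> else 0)"
  have "v c = \<eta>"
    using c by (simp add: v_def transition_derivative_self[OF M])
  moreover have "v \<in> hol_tangent_space A p"
    using c by (auto simp: hol_tangent_space_def v_def transition_derivative_cocycle[OF M])
  ultimately show ?thesis
    using that by blast
qed

lemma hol_tangent_space_scale:
  assumes "complex_manifold M A" "v \<in> hol_tangent_space A p"
  shows "(\<lambda>c. a *s v c) \<in> hol_tangent_space A p"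
proof -
  have v0: "v c = 0" if "\<not> (c \<in> A \<and> p \<in> fst c)" for c
    using assms(2) that unfolding hol_tangent_space_def by blast
  have "v d = frechet_derivative (transition c d) (at (snd c p)) (v c)"
    if "c \<in> A" "d \<in> A" "p \<in> fst c" "p \<in> fst d" for c d
    using assms(2) that unfolding hol_tangent_space_def by blast
  then have "a *s v d = frechet_derivative (transition c d) (at (snd c p)) (a *s v c)"
    if "c \<in> A" "d \<in> A" "p \<in> fst c" "p \<in> fst d" for c d
    using transition_differentiable(2)[OF assms(1)] that by metis
  moreover have "a *s v c = 0" if "\<not> (c \<in> A \<and> p \<in> fst c)" for c
    using v0[OF that] by simp
  ultimately show ?thesis
    unfolding hol_tangent_space_def by blast
qed

text \<open>\<open>local_expr\<close> inverts the bundle chart by \<open>inv_into\<close>, so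
  injectivity has to be secured first: a tangent vector is determined by its base point and its
  component in one chart.\<close>

lemma local_expr_bundle_chart:
  assumes M: "complex_manifold M A" and c: "c \<in> A" "p \<in> fst c" and v: "v \<in> hol_tangent_space A p"
  shows "local_expr M A f c (snd c p, v c) = f (p, v)"
proof -
  let ?B = "{w \<in> hol_tangent_bundle M A. fst w \<in> fst c}"
  have "inj_on (bundle_chart c) ?B"
  proof (rule inj_onI)
    fix w w' assume w: "w \<in> ?B" "w' \<in> ?B" "bundle_chart c w = bundle_chart c w'"
    obtain q u q' u' where wq: "w = (q, u)" "w' = (q', u')"
      by (metis surj_pair)
    have q: "q \<in> fst c" "q' \<in> fst c" "snd c q = snd c q'" and uc: "u c = u' c"
      using w by (simp_all add: wq bundle_chart_def)
    then have qq: "q' = q"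
      using chart_inj_on[OF M c(1)] by (metis inj_onD)
    then have u: "u \<in> hol_tangent_space A q" "u' \<in> hol_tangent_space A q"
      using w by (simp_all add: wq hol_tangent_bundle_def)
    have "u d = u' d" for d
    proof (cases "d \<in> A \<and> q \<in> fst d")
      case True
      then have "u d = frechet_derivative (transition c d) (at (snd c q)) (u c)"
        "u' d = frechet_derivative (transition c d) (at (snd c q)) (u' c)"
        using u c(1) q(1) unfolding hol_tangent_space_def by blast+
      then show ?thesis
        using uc by simp
    next
      case False
      then have "u d = 0" "u' d = 0"
        using u unfolding hol_tangent_space_def by blast+
      then show ?thesis by simp
    qed
    then show "w = w'"
      by (simp add: wq qq fun_eq_iff)
  qed
  moreover have "(p, v) \<in> ?B"
    using M c v unfolding complex_manifold_def hol_tangent_bundle_def by auto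
  ultimately have "inv_into ?B (bundle_chart c) (bundle_chart c (p, v)) = (p, v)"
    by (rule inv_into_f_f)
  then show ?thesis
    by (simp add: local_expr_def bundle_chart_def)
qed

text \<open>Homogeneity of F is given for tangent vectors, so \<eta> is lifted to some v at p. The
  scaled vector is again tangent because the transition derivatives are complex linear.\<close>

lemma L_local_scale:
  assumes F: "complex_finsler_space M A F" and c: "c \<in> A" and z: "z \<in> chart_image c"
  shows "L_local M A F c (z, a *s \<eta>) = (cmod a)\<^sup>2 * L_local M A F c (z, \<eta>)"
proof -
  have M: "complex_manifold M A"
    using F by (simp add: complex_finsler_space_def)
  obtain p where p: "p \<in> fst c" "z = snd c p"
    using z by (auto simp: chart_image_def)
  obtain v where v: "v \<in> hol_tangent_space A p" "v c = \<eta>"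
    using tangent_vector_exists[OF M c p(1)] .
  have "(p, v) \<in> hol_tangent_bundle M A"
    using M c p v unfolding complex_manifold_def hol_tangent_bundle_def by auto
  then have "F (p, \<lambda>c. a *s v c) = cmod a * F (p, v)"
    using F unfolding complex_finsler_space_def by blast
  then show ?thesis
    using local_expr_bundle_chart[OF M c p(1) v(1), of "\<lambda>w. (F w)\<^sup>2"]
      local_expr_bundle_chart[OF M c p(1) hol_tangent_space_scale[OF M v(1), of a], of "\<lambda>w. (F w)\<^sup>2"]
    by (simp add: L_local_def p v power_mult_distrib)
qed

lemma local_finsler_L_local:
  assumes F: "complex_finsler_space M A F" and c: "c \<in> A"
  shows "local_finsler (chart_image c) (L_local M A F c)"
proof
  show "open (chart_image c)"
    using F c unfolding complex_finsler_space_def complex_manifold_def by blast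
  show "C_infinity_on (chart_image c \<times> (UNIV - {0})) (L_local M A F c)"
    using F c unfolding complex_finsler_space_def slit_domain_def by blast
  show "hermitian_pos_def (g_mat (L_local M A F c) x)" if "x \<in> chart_image c \<times> (UNIV - {0})" for x
    using F c that unfolding complex_finsler_space_def slit_domain_def by blast
qed (rule L_local_scale[OF F c])

section \<open>Assembling the local results over all charts\<close>

theorem complex_berwald_iff:
  fixes M :: "'m topology"
    and A :: "('m, 'n::finite) chart set"
    and F :: "'m \<times> (('m, 'n) chart \<Rightarrow> complex^'n) \<Rightarrow> real"
  assumes "complex_finsler_space M A F"
  shows "complex_berwald M A F \<longleftrightarrow>
    weakly_kahler_finsler M A F \<and>
    (\<forall>c\<in>A. \<forall>x\<in>slit_domain c. \<forall>i h. d_eta_bar h (G_spray (L_local M A F c) i) x = 0)"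
proof (intro iffI conjI)
  assume B: "complex_berwald M A F"
  show "weakly_kahler_finsler M A F"
    unfolding weakly_kahler_finsler_def
  proof (intro ballI allI)
    fix c x k assume "c \<in> A" "x \<in> slit_domain c"
    then have T: "(\<Sum>j\<in>UNIV. T_torsion (L_local M A F c) i j k x * snd x $ j) = 0" for i
      using B unfolding complex_berwald_def kahler_finsler_def by blast
    \<comment> \<open>The weak condition is a further contraction of the Kaehler expression with g
      and \<eta>-bar, whose factors do not involve j.\<close>
    have "(\<Sum>j\<in>UNIV. g_mat (L_local M A F c) x $ i $ l * T_torsion (L_local M A F c) i j k x
             * snd x $ j * cnj (snd x $ l)) =
      g_mat (L_local M A F c) x $ i $ l * cnj (snd x $ l) *
        (\<Sum>j\<in>UNIV. T_torsion (L_local M A F c) i j k x * snd x $ j)" for i l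
      unfolding sum_distrib_left by (simp add: ac_simps)
    then show "(\<Sum>i\<in>UNIV. \<Sum>l\<in>UNIV. \<Sum>j\<in>UNIV.
           g_mat (L_local M A F c) x $ i $ l * T_torsion (L_local M A F c) i j k x
             * snd x $ j * cnj (snd x $ l)) = 0"
      by (simp add: T)
  qed
  show "\<forall>c\<in>A. \<forall>x\<in>slit_domain c. \<forall>i h. d_eta_bar h (G_spray (L_local M A F c) i) x = 0"
  proof (intro ballI allI)
    fix c x i h assume c: "c \<in> A" and x: "x \<in> slit_domain c"
    show "d_eta_bar h (G_spray (L_local M A F c) i) x = 0"
      by (rule local_finsler.G_holomorphic_of_constant_\<Gamma>[OF local_finsler_L_local[OF assms c]
            x[unfolded slit_domain_def]])
        (use B c in \<open>unfold complex_berwald_def, blast\<close>)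
  qed
next
  assume R: "weakly_kahler_finsler M A F \<and>
    (\<forall>c\<in>A. \<forall>x\<in>slit_domain c. \<forall>i h. d_eta_bar h (G_spray (L_local M A F c) i) x = 0)"
  have wk: "(\<Sum>i\<in>UNIV. \<Sum>l\<in>UNIV. \<Sum>j\<in>UNIV.
      g_mat (L_local M A F c) x $ i $ l * T_torsion (L_local M A F c) i j k x
        * snd x $ j * cnj (snd x $ l)) = 0"
    and hol: "d_eta_bar m (G_spray (L_local M A F c) i) x = 0"
    if "c \<in> A" "x \<in> chart_image c \<times> (UNIV - {0})" for c x k i m
    using R that unfolding weakly_kahler_finsler_def slit_domain_def by blast+
  show "complex_berwald M A F"
    unfolding complex_berwald_def kahler_finsler_def
  proof (intro conjI ballI allI impI)
    fix c i k x assume c: "c \<in> A" and "x \<in> slit_domain c"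
    then have x: "x \<in> chart_image c \<times> (UNIV - {0})" by (simp add: slit_domain_def)
    interpret local_finsler "chart_image c" "L_local M A F c"
      using assms c by (rule local_finsler_L_local)
    \<comment> \<open>By \<open>torsion_eta\<close> this equality is precisely the Kaehler
      condition.\<close>
    have "N i k x = d_eta k (G i) x"
      by (rule N_eq_d_eta_G[OF x wk[OF c] hol[OF c]])
    then show "(\<Sum>j\<in>UNIV. T_torsion (L_local M A F c) i j k x * snd x $ j) = 0"
      by (simp add: torsion_eta[OF x])
  next
    fix c z i j k and \<eta> \<eta>' :: "complex^'n"
    assume c: "c \<in> A" and z: "z \<in> chart_image c" and \<eta>: "\<eta> \<noteq> 0 \<and> \<eta>' \<noteq> 0"
    interpret local_finsler "chart_image c" "L_local M A F c"
      using assms c by (rule local_finsler_L_local)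
    show "\<Gamma> i j k (z, \<eta>) = \<Gamma> i j k (z, \<eta>')"
      by (rule \<Gamma>_constant_of_weakly_kahler[OF wk[OF c] hol[OF c] z conjunct1[OF \<eta>] conjunct2[OF \<eta>]])
  qed
qed

theorem theorem4p4:
  fixes M :: "'m topology"
    and A :: "('m, 2) chart set"
    and F :: "'m \<times> (('m, 2) chart \<Rightarrow> complex^2) \<Rightarrow> real"
  assumes "complex_finsler_space M A F"
  shows "complex_berwald M A F \<longleftrightarrow>
    weakly_kahler_finsler M A F \<and>
    (\<forall>c\<in>A. \<forall>x\<in>slit_domain c. \<forall>i h. d_eta_bar h (G_spray (L_local M A F c) i) x = 0)"
  using assms by (rule complex_berwald_iff)

end
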